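(* Let $H$ be a Hilbert space, $V$ a closed subspace of $B(H) \oplus B(H)$, $C$ the closed span of $\{v_1 w_2 : v, w \in V\}$, with $C \neq (0)$, and let $A = A(V)$ be the unital operator algebra in $B(H^{(7)})$ defined in the context. Then the canonical projection $P : A \to A$ which replaces the $1$-$3$ entry by $0$, whose kernel is a nontrivial square-zero ideal (the copy of $C$ in the $1$-$3$ entry) generated by $P(A)$, is a (real completely positive) completely bicontractive and unital projection, but its range is not a subalgebra, and it need not even be a Jordan subalgebra. A particularly simple case (which arises, up to complete isometric isomorphism, from $H = \mathbb{C}$ and $V = \mathbb{C} I_2$) is the algebra of $5 \times 5$ scalar matrices $$\begin{bmatrix} \lambda & \nu & c & 0 & 0 \\ 0 & \lambda & \nu & 0 & 0 \\ 0 & 0 & \lambda & 0 & 0 \\ 0 & 0 & 0 & \lambda & 2\nu \\ 0 & 0 & 0 & 0 & \lambda \end{bmatrix}, \qquad \lambda, \nu, c \in \mathbb{C},$$ with the projection being the replacement of the $1$-$3$ entry by $0$.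
   Context: Elements $v \in V$ are viewed as elements of $B(H^{(2)})$ supported on the $1$-$1$ and $2$-$2$ entries, with $v_1, v_2$ denoting the two parts of $v$. The algebra $A(V) \subset B(H^{(7)})$ consists of all elements $$\begin{bmatrix} \lambda I & v_1 & c & 0 & 0 & 0 & 0 \\ 0 & \lambda I & v_2 & 0 & 0 & 0 & 0 \\ 0 & 0 & \lambda I & 0 & 0 & 0 & 0 \\ 0 & 0 & 0 & \lambda I & 0 & 2v_1 & 0 \\ 0 & 0 & 0 & 0 & \lambda I & 0 & 2v_2 \\ 0 & 0 & 0 & 0 & 0 & \lambda I & 0 \\ 0 & 0 & 0 & 0 & 0 & 0 & \lambda I \end{bmatrix}, \qquad \lambda \in \mathbb{C},\ v \in V,\ c \in C .$$ A projection on $A$ is a linear idempotent map $P : A \to A$; it is completely bicontractive if $P$ and $I-P$ are completely contractive, and unital if $P(1)=1$. $P$ is real completely positive if for all $n$, $x \in M_n(A)$ with $x + x^* \geq 0$ implies $P_n(x) + P_n(x)^* \geq 0$, where $P_n$ is the amplification to $M_n(A)$. That the ideal is `generated by $P(A)$' means that it lies in the closed algebra generated by $P(A)$. A Jordan subalgebra is a closed subspace closed under squares $x \mapsto x^2$. *)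

theory Defs
  imports "HOL-Analysis.Analysis"
begin

section \<open>Complex Hilbert spaces\<close>

text \<open>
  A complex normed space or Hilbert space is a real one of the distribution together with a
  complex scalar multiplication and a complex inner product extending the real structure; the
  norm, topology and completeness are therefore those of the library classes.
\<close>

class complex_normed_vector = real_normed_vector +
  fixes scaleC :: "complex \<Rightarrow> 'a \<Rightarrow> 'a"  (infixr \<open>*\<^sub>C\<close> 75)
  assumes scaleR_scaleC: "r *\<^sub>R x = complex_of_real r *\<^sub>C x"
    and scaleC_add_right: "a *\<^sub>C (x + y) = a *\<^sub>C x + a *\<^sub>C y"
    and scaleC_add_left: "(a + b) *\<^sub>C x = a *\<^sub>C x + b *\<^sub>C x"
    and scaleC_scaleC: "a *\<^sub>C b *\<^sub>C x = (a * b) *\<^sub>C x"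
    and scaleC_one: "1 *\<^sub>C x = x"
    and norm_scaleC: "norm (a *\<^sub>C x) = cmod a * norm x"

text \<open>
  The inner product is linear in its first argument. Definiteness and the formula for the norm
  are inherited from \<open>real_inner\<close> through the last axiom.
\<close>

class complex_hilbert = real_inner + complete_space + complex_normed_vector +
  fixes cinner :: "'a \<Rightarrow> 'a \<Rightarrow> complex"
  assumes cinner_commute: "cinner x y = cnj (cinner y x)"
    and cinner_add_left: "cinner (x + y) z = cinner x z + cinner y z"
    and cinner_scaleC_left: "cinner (a *\<^sub>C x) y = a * cinner x y"
    and inner_eq_Re_cinner: "inner x y = Re (cinner x y)"

lemma vector_space_scaleC:
  "vector_space (scaleC :: complex \<Rightarrow> 'a::complex_normed_vector \<Rightarrow> 'a)"
  by unfold_locales (auto simp: scaleC_add_right scaleC_add_left scaleC_scaleC scaleC_one)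

lemma cinner_self: "cinner x x = complex_of_real ((norm (x :: 'a::complex_hilbert))\<^sup>2)"
proof -
  have "Im (cinner x x) = 0"
    using arg_cong[OF cinner_commute[of x x], of Im] by simp
  then show ?thesis
    by (simp add: complex_eq_iff power2_norm_eq_inner inner_eq_Re_cinner)
qed

abbreviation csubspace :: "'a::complex_normed_vector set \<Rightarrow> bool"
  where "csubspace \<equiv> module.subspace scaleC"

abbreviation cspan :: "'a::complex_normed_vector set \<Rightarrow> 'a set"
  where "cspan \<equiv> module.span scaleC"

instantiation complex :: complex_hilbert
begin

definition scaleC_complex :: "complex \<Rightarrow> complex \<Rightarrow> complex"
  where "scaleC_complex a x = a * x"

definition cinner_complex :: "complex \<Rightarrow> complex \<Rightarrow> complex"
  where "cinner_complex x y = x * cnj y"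

instance
  by intro_classes
    (auto simp: scaleC_complex_def cinner_complex_def algebra_simps norm_mult inner_complex_def
      scaleR_conv_of_real)

end

instantiation prod :: (complex_normed_vector, complex_normed_vector) complex_normed_vector
begin

definition scaleC_prod :: "complex \<Rightarrow> 'a \<times> 'b \<Rightarrow> 'a \<times> 'b"
  where "scaleC_prod a x = (a *\<^sub>C fst x, a *\<^sub>C snd x)"

instance
proof
  fix a :: complex and x :: "'a \<times> 'b"
  show "norm (a *\<^sub>C x) = cmod a * norm x"
    by (simp add: scaleC_prod_def norm_prod_def norm_scaleC power_mult_distrib real_sqrt_mult
        flip: distrib_left)
qed (auto simp: scaleC_prod_def scaleR_scaleC scaleC_add_right scaleC_add_left scaleC_scaleC
    scaleC_one prod_eq_iff)

end

text \<open>For finite \<open>'n\<close>, \<open>'h ^ 'n\<close> is the Hilbert space direct sum of copies of \<open>'h\<close>.\<close>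

instantiation vec :: (complex_normed_vector, finite) complex_normed_vector
begin

definition scaleC_vec :: "complex \<Rightarrow> 'a ^ 'b \<Rightarrow> 'a ^ 'b"
  where "scaleC_vec a x = (\<chi> i. a *\<^sub>C (x $ i))"

instance
proof
  fix a :: complex and x :: "'a ^ 'b"
  show "norm (a *\<^sub>C x) = cmod a * norm x"
    by (simp add: scaleC_vec_def norm_vec_def norm_scaleC L2_set_right_distrib)
qed (auto simp: scaleC_vec_def scaleR_scaleC scaleC_add_right scaleC_add_left scaleC_scaleC
    scaleC_one vec_eq_iff)

end

instantiation vec :: (complex_hilbert, finite) complex_hilbert
begin

definition cinner_vec :: "'a ^ 'b \<Rightarrow> 'a ^ 'b \<Rightarrow> complex"
  where "cinner_vec x y = (\<Sum>i\<in>UNIV. cinner (x $ i) (y $ i))"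

instance
proof
  fix x y z :: "'a ^ 'b" and a :: complex
  show "cinner x y = cnj (cinner y x)"
    unfolding cinner_vec_def cnj_sum by (intro sum.cong refl cinner_commute)
  show "cinner (x + y) z = cinner x z + cinner y z"
    by (simp add: cinner_vec_def cinner_add_left sum.distrib)
  show "cinner (a *\<^sub>C x) y = a * cinner x y"
    by (simp add: cinner_vec_def scaleC_vec_def cinner_scaleC_left sum_distrib_left)
  show "inner x y = Re (cinner x y)"
    by (simp add: cinner_vec_def inner_vec_def inner_eq_Re_cinner)
qed

end

lemma bounded_linear_scaleC: "bounded_linear (\<lambda>x :: 'a::complex_normed_vector. a *\<^sub>C x)"
  by (rule bounded_linear_intro[where K = "cmod a"])
    (auto simp: scaleC_add_right norm_scaleC scaleR_scaleC scaleC_scaleC mult.commute)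

instantiation blinfun :: (real_normed_vector, complex_normed_vector) complex_normed_vector
begin

definition scaleC_blinfun :: "complex \<Rightarrow> 'a \<Rightarrow>\<^sub>L 'b \<Rightarrow> 'a \<Rightarrow>\<^sub>L 'b"
  where "scaleC_blinfun a f = Blinfun (\<lambda>x. a *\<^sub>C blinfun_apply f x)"

lemma scaleC_blinfun_apply: "blinfun_apply (a *\<^sub>C f) x = a *\<^sub>C blinfun_apply f x"
  for f :: "'a \<Rightarrow>\<^sub>L 'b"
  unfolding scaleC_blinfun_def
  by (simp add: bounded_linear_Blinfun_apply
      bounded_linear_compose[OF bounded_linear_scaleC blinfun.bounded_linear_right])

instance
proof
  fix a :: complex and f :: "'a \<Rightarrow>\<^sub>L 'b"
  have le: "norm (b *\<^sub>C g) \<le> cmod b * norm g" for b and g :: "'a \<Rightarrow>\<^sub>L 'b"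
    by (rule norm_blinfun_bound)
      (auto simp: scaleC_blinfun_apply norm_scaleC mult.assoc intro!: mult_left_mono norm_blinfun)
  show "norm (a *\<^sub>C f) = cmod a * norm f"
  proof (cases "a = 0")
    case True
    then show ?thesis using le[of a f] by simp
  next
    case False
    have "inverse a *\<^sub>C a *\<^sub>C f = f"
      using False by (intro blinfun_eqI) (simp add: scaleC_blinfun_apply scaleC_scaleC scaleC_one)
    then have "norm f \<le> cmod (inverse a) * norm (a *\<^sub>C f)"
      using le[of "inverse a" "a *\<^sub>C f"] by simp
    then show ?thesis
      using le[of a f] False by (simp add: norm_inverse norm_divide field_simps)
  qed
qed (auto intro!: blinfun_eqI simp: scaleC_blinfun_apply blinfun.add_left blinfun.scaleR_left
    scaleR_scaleC scaleC_add_right scaleC_add_left scaleC_scaleC scaleC_one)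

end


section \<open>Operators and operator algebras\<close>

text \<open>
  The library type \<open>'k \<Rightarrow>\<^sub>L 'k\<close> consists of the bounded real-linear maps, with the
  operator norm; \<open>B('k)\<close> is its subset of complex-linear maps.
\<close>

definition bounded_ops :: "('k::complex_hilbert \<Rightarrow>\<^sub>L 'k) set"
  where "bounded_ops = {T. \<forall>a x. blinfun_apply T (a *\<^sub>C x) = a *\<^sub>C blinfun_apply T x}"

definition cadjoint :: "('k::complex_hilbert \<Rightarrow>\<^sub>L 'k) \<Rightarrow> ('k \<Rightarrow>\<^sub>L 'k)"
  where "cadjoint T =
    (THE S. \<forall>x y. cinner (blinfun_apply T x) y = cinner x (blinfun_apply S y))"

text \<open>Riesz representation, which shows that the adjoint above is well defined.\<close>

lemma riesz_representation:
  fixes f :: "'a::{real_inner,complete_space} \<Rightarrow> real"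
  assumes "bounded_linear f"
  shows "\<exists>z. \<forall>x. f x = inner x z"
proof -
  interpret f: bounded_linear f by fact
  define J where "J x = (norm x)\<^sup>2 - 2 * f x" for x
  obtain K where K: "\<And>x. norm (f x) \<le> norm x * K"
    using f.bounded by blast
  have "- K\<^sup>2 \<le> J x" for x
  proof -
    have "f x \<le> norm x * K" using K[of x] by simp
    moreover have "0 \<le> (norm x - K)\<^sup>2" by simp
    ultimately show ?thesis by (simp add: J_def power2_diff)
  qed
  then have bdd: "bdd_below (range J)" by (auto simp: bdd_below_def)
  define m where "m = Inf (range J)"
  have m_le: "m \<le> J x" for x
    unfolding m_def by (rule cInf_lower) (use bdd in auto)
  have "\<exists>x. J x < m + inverse (real (Suc n))" for n
    using cInf_lessD[of "range J" "m + inverse (real (Suc n))"] by (auto simp: m_def)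
  then obtain u where u: "\<And>n. J (u n) < m + inverse (real (Suc n))"
    by metis
  have par: "(norm (a - b))\<^sup>2 \<le> 2 * J a + 2 * J b - 4 * m" for a b
  proof -
    have "4 * J ((1/2) *\<^sub>R (a + b)) = 2 * J a + 2 * J b - (norm (a - b))\<^sup>2"
      by (simp add: J_def power2_norm_eq_inner inner_add_left inner_add_right inner_diff_left
          inner_diff_right f.scaleR f.add inner_commute field_simps)
    then show ?thesis using m_le[of "(1/2) *\<^sub>R (a + b)"] by linarith
  qed
  have "Cauchy u"
  proof (rule metric_CauchyI)
    fix e :: real assume "0 < e"
    then obtain N where N: "inverse (real (Suc N)) < e\<^sup>2 / 4"
      using reals_Archimedean[of "e\<^sup>2 / 4"] by auto
    have "dist (u p) (u q) < e" if "p \<ge> N" "q \<ge> N" for p q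
    proof -
      have "inverse (real (Suc p)) \<le> inverse (real (Suc N))"
        "inverse (real (Suc q)) \<le> inverse (real (Suc N))"
        using that by (auto intro: le_imp_inverse_le)
      then have "(norm (u p - u q))\<^sup>2 < e\<^sup>2"
        using par[of "u p" "u q"] u[of p] u[of q] N by linarith
      then show ?thesis
        using \<open>0 < e\<close> by (simp add: dist_norm power2_less_imp_less)
    qed
    then show "\<exists>M. \<forall>p\<ge>M. \<forall>q\<ge>M. dist (u p) (u q) < e" by blast
  qed
  then obtain z where z: "u \<longlonglongrightarrow> z"
    using Cauchy_convergent convergent_def by blast
  have "(\<lambda>n. J (u n)) \<longlonglongrightarrow> J z"
    unfolding J_def by (intro tendsto_intros f.tendsto z)
  moreover have "(\<lambda>n. m + inverse (real (Suc n))) \<longlonglongrightarrow> m"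
    using tendsto_add[OF tendsto_const LIMSEQ_inverse_real_of_nat] by simp
  ultimately have "J z \<le> m"
    by (rule LIMSEQ_le) (use u less_imp_le in blast)
  then have min: "J z \<le> J x" for x
    using m_le[of x] by simp
  have "f x = inner x z" for x
  proof (rule ccontr)
    define d where "d = inner x z - f x"
    assume "f x \<noteq> inner x z"
    then have "d \<noteq> 0" by (simp add: d_def)
    then have "x \<noteq> 0" by (auto simp: d_def f.zero)
    define t where "t = - d / (norm x)\<^sup>2"
    have "J (z + t *\<^sub>R x) = J z + 2 * t * d + t\<^sup>2 * (norm x)\<^sup>2"
      by (simp add: J_def d_def power2_norm_eq_inner inner_add_left inner_add_right f.scaleR f.add
          inner_commute power2_eq_square[of t] algebra_simps)
    also have "\<dots> = J z - d\<^sup>2 / (norm x)\<^sup>2"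
      using \<open>x \<noteq> 0\<close> by (simp add: t_def power2_eq_square field_simps)
    also have "\<dots> < J z"
      using \<open>x \<noteq> 0\<close> \<open>d \<noteq> 0\<close> by simp
    finally show False using min[of "z + t *\<^sub>R x"] by simp
  qed
  then show ?thesis by blast
qed

lemma cinner_cadjoint:
  assumes "T \<in> bounded_ops"
  shows "cinner (blinfun_apply T x) y = cinner x (blinfun_apply (cadjoint T) y)"
proof -
  have "\<exists>z. \<forall>x. inner (blinfun_apply T x) y = inner x z" for y
    by (intro riesz_representation bounded_linear_compose[OF bounded_linear_inner_left]
        blinfun.bounded_linear_right)
  then obtain g where g: "\<And>x y. inner (blinfun_apply T x) y = inner x (g y)"
    by metis
  have eqI: "a = b" if "\<And>x. inner x a = inner x b" for a b :: 'a
  proof -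
    have "inner (a - b) (a - b) = 0" using that[of "a - b"] by (simp add: inner_diff_right)
    then show ?thesis by simp
  qed
  have "bounded_linear g"
  proof (rule bounded_linear_intro[where K = "norm T"])
    fix a b r
    show "g (a + b) = g a + g b"
      by (rule eqI) (simp add: g[symmetric] inner_add_right)
    show "g (r *\<^sub>R a) = r *\<^sub>R g a"
      by (rule eqI) (simp add: g[symmetric])
    have "(norm (g a))\<^sup>2 = inner (blinfun_apply T (g a)) a"
      by (simp add: g power2_norm_eq_inner)
    also have "\<dots> \<le> norm (blinfun_apply T (g a)) * norm a"
      by (rule norm_cauchy_schwarz)
    also have "\<dots> \<le> (norm T * norm (g a)) * norm a"
      by (intro mult_right_mono norm_blinfun) auto
    finally have "norm (g a) * norm (g a) \<le> norm (g a) * (norm a * norm T)"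
      by (simp add: power2_eq_square mult_ac)
    then show "norm (g a) \<le> norm a * norm T"
      by (cases "norm (g a) = 0") (auto simp: mult_le_cancel_left)
  qed
  then have S: "inner (blinfun_apply T x) y = inner x (blinfun_apply (Blinfun g) y)" for x y
    by (simp add: g bounded_linear_Blinfun_apply)
  have im: "Im (cinner a b) = - inner (\<i> *\<^sub>C a) b" for a b :: 'a
    by (simp add: inner_eq_Re_cinner cinner_scaleC_left)
  have adj: "cinner (blinfun_apply T x) y = cinner x (blinfun_apply (Blinfun g) y)" for x y
    using S[of x y] S[of "\<i> *\<^sub>C x" y] assms
    by (simp add: complex_eq_iff im bounded_ops_def inner_eq_Re_cinner[symmetric])
  have "\<forall>x y. cinner (blinfun_apply T x) y = cinner x (blinfun_apply (cadjoint T) y)"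
    unfolding cadjoint_def
  proof (rule theI)
    show "\<forall>x y. cinner (blinfun_apply T x) y = cinner x (blinfun_apply (Blinfun g) y)"
      using adj by blast
    fix R assume "\<forall>x y. cinner (blinfun_apply T x) y = cinner x (blinfun_apply R y)"
    then show "R = Blinfun g"
      by (intro blinfun_eqI eqI) (simp add: inner_eq_Re_cinner flip: adj)
  qed
  then show ?thesis by blast
qed

definition subalgebra :: "('k::complex_hilbert \<Rightarrow>\<^sub>L 'k) set \<Rightarrow> bool"
  where "subalgebra B \<longleftrightarrow>
    B \<subseteq> bounded_ops \<and> csubspace B \<and> (\<forall>x\<in>B. \<forall>y\<in>B. x o\<^sub>L y \<in> B)"

definition jordan_subalgebra :: "('k::complex_hilbert \<Rightarrow>\<^sub>L 'k) set \<Rightarrow> bool"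
  where "jordan_subalgebra B \<longleftrightarrow>
    B \<subseteq> bounded_ops \<and> csubspace B \<and> closed B \<and> (\<forall>x\<in>B. x o\<^sub>L x \<in> B)"

definition unital_operator_algebra :: "('k::complex_hilbert \<Rightarrow>\<^sub>L 'k) set \<Rightarrow> bool"
  where "unital_operator_algebra A \<longleftrightarrow> subalgebra A \<and> closed A \<and> id_blinfun \<in> A"

definition closed_algebra_generated ::
  "('k::complex_hilbert \<Rightarrow>\<^sub>L 'k) set \<Rightarrow> ('k \<Rightarrow>\<^sub>L 'k) set"
  where "closed_algebra_generated S = \<Inter>{B. subalgebra B \<and> closed B \<and> S \<subseteq> B}"

definition closed_ideal ::
  "('k::complex_hilbert \<Rightarrow>\<^sub>L 'k) set \<Rightarrow> ('k \<Rightarrow>\<^sub>L 'k) set \<Rightarrow> bool"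
  where "closed_ideal A J \<longleftrightarrow>
    J \<subseteq> A \<and> csubspace J \<and> closed J \<and> (\<forall>a\<in>A. \<forall>x\<in>J. a o\<^sub>L x \<in> J \<and> x o\<^sub>L a \<in> J)"

definition square_zero :: "('k::complex_hilbert \<Rightarrow>\<^sub>L 'k) set \<Rightarrow> bool"
  where "square_zero J \<longleftrightarrow> (\<forall>x\<in>J. \<forall>y\<in>J. x o\<^sub>L y = 0)"


section \<open>Matrix amplifications\<close>

text \<open>
  An element of \<open>M\<^sub>n(A)\<close> is a function \<open>x :: nat \<Rightarrow> nat \<Rightarrow> _\<close> with \<open>x i j \<in> A\<close>
  for \<open>i, j < n\<close>; values at other indices are irrelevant. It acts on the direct sum of \<open>n\<close>
  copies of \<open>'k\<close>, whose elements are likewise functions read only at indices below \<open>n\<close>.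
\<close>

definition matrices_over :: "nat \<Rightarrow> 'a set \<Rightarrow> (nat \<Rightarrow> nat \<Rightarrow> 'a) set"
  where "matrices_over n A = {x. \<forall>i<n. \<forall>j<n. x i j \<in> A}"

definition amplification :: "('a \<Rightarrow> 'b) \<Rightarrow> (nat \<Rightarrow> nat \<Rightarrow> 'a) \<Rightarrow> (nat \<Rightarrow> nat \<Rightarrow> 'b)"
  where "amplification f x = (\<lambda>i j. f (x i j))"

definition mat_norm :: "nat \<Rightarrow> (nat \<Rightarrow> nat \<Rightarrow> 'k::complex_hilbert \<Rightarrow>\<^sub>L 'k) \<Rightarrow> real"
  where "mat_norm n x =
    (SUP \<xi>\<in>{\<xi>. L2_set (\<lambda>j. norm (\<xi> j)) {..<n} \<le> 1}.
       L2_set (\<lambda>i. norm (\<Sum>j<n. blinfun_apply (x i j) (\<xi> j))) {..<n})"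

definition mat_positive :: "nat \<Rightarrow> (nat \<Rightarrow> nat \<Rightarrow> 'k::complex_hilbert \<Rightarrow>\<^sub>L 'k) \<Rightarrow> bool"
  where "mat_positive n x \<longleftrightarrow>
    (\<forall>\<xi>. (\<Sum>i<n. cinner (\<Sum>j<n. blinfun_apply (x i j) (\<xi> j)) (\<xi> i)) \<in> \<real>\<^sub>\<ge>\<^sub>0)"

definition mat_adjoint ::
  "(nat \<Rightarrow> nat \<Rightarrow> 'k::complex_hilbert \<Rightarrow>\<^sub>L 'k) \<Rightarrow> (nat \<Rightarrow> nat \<Rightarrow> 'k \<Rightarrow>\<^sub>L 'k)"
  where "mat_adjoint x = (\<lambda>i j. cadjoint (x j i))"

definition clinear_on ::
  "'a::complex_normed_vector set \<Rightarrow> ('a \<Rightarrow> 'b::complex_normed_vector) \<Rightarrow> bool"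
  where "clinear_on A f \<longleftrightarrow>
    (\<forall>x\<in>A. \<forall>y\<in>A. f (x + y) = f x + f y) \<and> (\<forall>a. \<forall>x\<in>A. f (a *\<^sub>C x) = a *\<^sub>C f x)"

definition projection_on ::
  "'a::complex_normed_vector set \<Rightarrow> ('a \<Rightarrow> 'a) \<Rightarrow> bool"
  where "projection_on A P \<longleftrightarrow>
    P ` A \<subseteq> A \<and> clinear_on A P \<and> (\<forall>x\<in>A. P (P x) = P x)"

definition completely_contractive_on ::
  "('k::complex_hilbert \<Rightarrow>\<^sub>L 'k) set \<Rightarrow> (('k \<Rightarrow>\<^sub>L 'k) \<Rightarrow> ('l::complex_hilbert \<Rightarrow>\<^sub>L 'l)) \<Rightarrow> bool"
  where "completely_contractive_on A f \<longleftrightarrow>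
    (\<forall>n. \<forall>x\<in>matrices_over n A. mat_norm n (amplification f x) \<le> mat_norm n x)"

definition completely_bicontractive_on ::
  "('k::complex_hilbert \<Rightarrow>\<^sub>L 'k) set \<Rightarrow> (('k \<Rightarrow>\<^sub>L 'k) \<Rightarrow> ('k \<Rightarrow>\<^sub>L 'k)) \<Rightarrow> bool"
  where "completely_bicontractive_on A P \<longleftrightarrow>
    completely_contractive_on A P \<and> completely_contractive_on A (\<lambda>x. x - P x)"

definition real_completely_positive_on ::
  "('k::complex_hilbert \<Rightarrow>\<^sub>L 'k) set \<Rightarrow> (('k \<Rightarrow>\<^sub>L 'k) \<Rightarrow> ('k \<Rightarrow>\<^sub>L 'k)) \<Rightarrow> bool"
  where "real_completely_positive_on A P \<longleftrightarrow>
    (\<forall>n. \<forall>x\<in>matrices_over n A.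
       mat_positive n (\<lambda>i j. x i j + mat_adjoint x i j) \<longrightarrow>
       mat_positive n (\<lambda>i j. amplification P x i j + mat_adjoint (amplification P x) i j))"

definition completely_isometric_isomorphism ::
  "('k::complex_hilbert \<Rightarrow>\<^sub>L 'k) set \<Rightarrow> ('l::complex_hilbert \<Rightarrow>\<^sub>L 'l) set
    \<Rightarrow> (('k \<Rightarrow>\<^sub>L 'k) \<Rightarrow> ('l \<Rightarrow>\<^sub>L 'l)) \<Rightarrow> bool"
  where "completely_isometric_isomorphism A B f \<longleftrightarrow>
    bij_betw f A B \<and> clinear_on A f \<and> (\<forall>x\<in>A. \<forall>y\<in>A. f (x o\<^sub>L y) = f x o\<^sub>L f y) \<and>
    (\<forall>n. \<forall>x\<in>matrices_over n A. mat_norm n (amplification f x) = mat_norm n x)"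


section \<open>Block operators and the algebra of the construction\<close>

definition block_op :: "('h::complex_hilbert \<Rightarrow>\<^sub>L 'h) ^ 'n ^ 'n \<Rightarrow> (('h ^ 'n) \<Rightarrow>\<^sub>L ('h ^ 'n))"
  where "block_op M = Blinfun (\<lambda>\<xi>. \<chi> i. \<Sum>j\<in>UNIV. blinfun_apply (M $ i $ j) (\<xi> $ j))"

definition block_entry :: "(('h::complex_hilbert ^ 'n) \<Rightarrow>\<^sub>L ('h ^ 'n)) \<Rightarrow> 'n \<Rightarrow> 'n \<Rightarrow> ('h \<Rightarrow>\<^sub>L 'h)"
  where "block_entry T i j = Blinfun (\<lambda>x. blinfun_apply T (axis j x) $ i)"

lemma block_op_apply:
  "blinfun_apply (block_op M) \<xi> = (\<chi> i. \<Sum>j\<in>UNIV. blinfun_apply (M $ i $ j) (\<xi> $ j))"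
proof -
  have "linear (\<lambda>\<xi>. \<chi> i. \<Sum>j\<in>UNIV. blinfun_apply (M $ i $ j) (\<xi> $ j))"
    by (intro linearI)
      (auto simp: vec_eq_iff blinfun.add_right blinfun.scaleR_right sum.distrib scaleR_sum_right)
  moreover have "norm (\<chi> i. \<Sum>j\<in>UNIV. blinfun_apply (M $ i $ j) (\<xi> $ j))
      \<le> norm \<xi> * (\<Sum>i\<in>UNIV. \<Sum>j\<in>UNIV. norm (M $ i $ j))" for \<xi>
  proof -
    have "norm (\<chi> i. \<Sum>j\<in>UNIV. blinfun_apply (M $ i $ j) (\<xi> $ j))
        \<le> (\<Sum>i\<in>UNIV. norm (\<Sum>j\<in>UNIV. blinfun_apply (M $ i $ j) (\<xi> $ j)))"
      unfolding norm_vec_def by (rule order_trans[OF L2_set_le_sum]) auto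
    also have "\<dots> \<le> (\<Sum>i\<in>UNIV. \<Sum>j\<in>UNIV. norm (M $ i $ j) * norm \<xi>)"
      by (intro sum_mono order_trans[OF norm_sum] order_trans[OF norm_blinfun] mult_left_mono
          Finite_Cartesian_Product.norm_nth_le) auto
    finally show ?thesis by (simp add: sum_distrib_left mult.commute)
  qed
  ultimately have "bounded_linear (\<lambda>\<xi>. \<chi> i. \<Sum>j\<in>UNIV. blinfun_apply (M $ i $ j) (\<xi> $ j))"
    unfolding bounded_linear_def bounded_linear_axioms_def by blast
  then show ?thesis
    unfolding block_op_def by (simp add: bounded_linear_Blinfun_apply)
qed

lemma block_entry_apply: "blinfun_apply (block_entry T i j) x = blinfun_apply T (axis j x) $ i"
proof -
  have "bounded_linear (\<lambda>x :: 'a. axis j x :: 'a ^ 'b)"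
    by (rule bounded_linear_intro[where K = 1])
      (auto simp: axis_def vec_eq_iff norm_vec_def L2_set_def if_distrib[of norm]
        if_distrib[of "\<lambda>t. t\<^sup>2"] cong: if_cong)
  then have "bounded_linear (\<lambda>x. blinfun_apply T (axis j x) $ i)"
    by (intro bounded_linear_compose[OF bounded_linear_vec_nth]
        bounded_linear_compose[OF blinfun.bounded_linear_right])
  then show ?thesis
    unfolding block_entry_def by (simp add: bounded_linear_Blinfun_apply)
qed

lemma block_entry_block_op: "block_entry (block_op M) i j = M $ i $ j"
  by (rule blinfun_eqI)
    (simp add: block_entry_apply block_op_apply axis_def if_distrib[of "blinfun_apply _"]
      cong: if_cong)

text \<open>
  The index types \<open>5\<close> and \<open>7\<close> have the elements \<open>1, \<dots>, 5\<close> and \<open>1, \<dots>, 7\<close>,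
  with the last one equal to \<open>0\<close>.
\<close>

definition replace13 ::
  "(('h::complex_hilbert ^ 'n::{finite,numeral}) \<Rightarrow>\<^sub>L ('h ^ 'n::{finite,numeral}))
    \<Rightarrow> (('h ^ 'n::{finite,numeral}) \<Rightarrow>\<^sub>L ('h ^ 'n::{finite,numeral}))"
  where "replace13 T = block_op (\<chi> i j. if i = 1 \<and> j = 3 then 0 else block_entry T i j)"

definition embed13 ::
  "('h::complex_hilbert \<Rightarrow>\<^sub>L 'h) \<Rightarrow> (('h ^ 'n::{finite,numeral}) \<Rightarrow>\<^sub>L ('h ^ 'n::{finite,numeral}))"
  where "embed13 c = block_op (\<chi> i j. if i = 1 \<and> j = 3 then c else 0)"

text \<open>
  A pair in \<open>V\<close> lists the two diagonal entries of the corresponding element of \<open>B(H \<oplus> H)\<close>.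
  Closedness of \<open>V\<close> refers to the product topology, which is also that of the norm of
  \<open>B(H \<oplus> H)\<close>.
\<close>

definition product_span ::
  "(('h::complex_hilbert \<Rightarrow>\<^sub>L 'h) \<times> ('h \<Rightarrow>\<^sub>L 'h)) set \<Rightarrow> ('h \<Rightarrow>\<^sub>L 'h) set"
  where "product_span V = closure (cspan {fst v o\<^sub>L snd w | v w. v \<in> V \<and> w \<in> V})"

definition algebra_elt ::
  "complex \<Rightarrow> ('h::complex_hilbert \<Rightarrow>\<^sub>L 'h) \<times> ('h \<Rightarrow>\<^sub>L 'h) \<Rightarrow> ('h \<Rightarrow>\<^sub>L 'h)
    \<Rightarrow> (('h ^ 7) \<Rightarrow>\<^sub>L ('h ^ 7))"
  where "algebra_elt l v c = block_op (\<chi> i j.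
    if i = j then l *\<^sub>C id_blinfun
    else if i = 1 \<and> j = 2 then fst v
    else if i = 1 \<and> j = 3 then c
    else if i = 2 \<and> j = 3 then snd v
    else if i = 4 \<and> j = 6 then 2 *\<^sub>C fst v
    else if i = 5 \<and> j = 7 then 2 *\<^sub>C snd v
    else 0)"

definition algebra_of ::
  "(('h::complex_hilbert \<Rightarrow>\<^sub>L 'h) \<times> ('h \<Rightarrow>\<^sub>L 'h)) set \<Rightarrow> (('h ^ 7) \<Rightarrow>\<^sub>L ('h ^ 7)) set"
  where "algebra_of V = {algebra_elt l v c | l v c. v \<in> V \<and> c \<in> product_span V}"

definition scalar_pairs :: "((complex \<Rightarrow>\<^sub>L complex) \<times> (complex \<Rightarrow>\<^sub>L complex)) set"
  where "scalar_pairs = {(a *\<^sub>C id_blinfun, a *\<^sub>C id_blinfun) | a. True}"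

definition matrix_op :: "complex ^ 'n ^ 'n \<Rightarrow> ((complex ^ 'n) \<Rightarrow>\<^sub>L (complex ^ 'n))"
  where "matrix_op M = Blinfun (\<lambda>x. M *v x)"

lemma matrix_op_eq_block_op: "matrix_op M = block_op (\<chi> i j. M $ i $ j *\<^sub>C id_blinfun)"
  unfolding matrix_op_def block_op_def
  by (simp add: matrix_vector_mult_def[abs_def] scaleC_blinfun_apply scaleC_complex_def)

definition algebra5 :: "((complex ^ 5) \<Rightarrow>\<^sub>L (complex ^ 5)) set"
  where "algebra5 = {matrix_op (\<chi> i j.
    if i = j then l
    else if i = 1 \<and> j = 2 \<or> i = 2 \<and> j = 3 then \<nu>
    else if i = 1 \<and> j = 3 then c
    else if i = 4 \<and> j = 5 then 2 * \<nu>
    else 0) | l \<nu> c. True}"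

end

theory Submission
  imports Defs
begin

text \<open>
  Write \<open>T(v)\<close> for the upper left corner of an element of \<open>A(V)\<close> with its \<open>1\<close>-\<open>3\<close> entry
  replaced by \<open>0\<close>. It is the average of the two matrices obtained from it by doubling one of
  the entries \<open>v\<^sub>1\<close>, \<open>v\<^sub>2\<close> and deleting the other. Up to the order of the coordinates, each of
  these two is a direct sum of compressions of the lower right corner, where \<open>2v\<^sub>1\<close> and \<open>2v\<^sub>2\<close>
  occur. Hence on \<open>A(V)\<close> the projection has the form \<open>x \<mapsto> \<Sum>\<^sub>k w\<^sub>k S\<^sub>k\<^sup>* x S\<^sub>k\<close> with
  \<open>\<Sum>\<^sub>k w\<^sub>k S\<^sub>k\<^sup>* S\<^sub>k = I\<close>. A map of this form is completely contractive and real completely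
  positive, whatever the algebra: \<open>mat_norm_sum_compressions_le\<close> and \<open>form_sum_compressions\<close>.
  The complementary projection only keeps the \<open>1\<close>-\<open>3\<close> entry, so it is a compression between two
  coordinates, and the same norm estimate applies with different maps on the two sides.

  The algebraic claims depend on very little. An element is \<open>\<lambda>I + N(v) + E(c)\<close>, where \<open>E(c)\<close> has
  the single entry \<open>c\<close> at \<open>1\<close>-\<open>3\<close>, the product \<open>N(v) N(w)\<close> is \<open>E(v\<^sub>1 w\<^sub>2)\<close>, and all other products of
  the \<open>N\<close> and \<open>E\<close> parts vanish. So the range of the projection contains \<open>N(v)\<close> and
  \<open>N(w)\<close>, whose products generate the kernel, which meets that range only in \<open>0\<close>. The locale
  \<open>superdiagonal\<close> collects these relations together with the averaging formula; the algebra of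
  \<open>7 \<times> 7\<close> operator matrices and the algebra of \<open>5 \<times> 5\<close> scalar matrices are both instances.

  In the scalar case the \<open>4\<close>-\<open>6\<close> and \<open>5\<close>-\<open>7\<close> corners are two copies of the same
  \<open>2 \<times> 2\<close> matrix. Deleting one copy gives the \<open>5 \<times> 5\<close> algebra. This map is a compression, and its
  inverse is a sum of two compressions to orthogonal blocks; both are therefore complete
  contractions.
\<close>

section \<open>Complex-linear preliminaries\<close>

interpretation cvs: vector_space "scaleC :: complex \<Rightarrow> 'a::complex_normed_vector \<Rightarrow> 'a"
  by (rule vector_space_scaleC)

lemma scaleC_numeral: "numeral k *\<^sub>C x = numeral k *\<^sub>R (x :: 'a::complex_normed_vector)"
  by (simp add: scaleR_scaleC)

lemma bounded_linear_scaleC_left: "bounded_linear (\<lambda>a. a *\<^sub>C (x :: 'a::complex_normed_vector))"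
  by (rule bounded_linear_intro[where K = "norm x"])
    (simp_all add: scaleC_add_left norm_scaleC scaleR_scaleC scaleC_scaleC scaleC_complex_def)

lemma csubspace_closure:
  assumes "csubspace (S :: 'a::complex_normed_vector set)"
  shows "csubspace (closure S)"
proof (rule cvs.subspaceI)
  show "0 \<in> closure S"
    using cvs.subspace_0[OF assms] closure_subset by blast
next
  fix x y assume "x \<in> closure S" "y \<in> closure S"
  then obtain f g where "\<And>n. f n \<in> S" "f \<longlonglongrightarrow> x" "\<And>n. g n \<in> S" "g \<longlonglongrightarrow> y"
    by (auto simp: closure_sequential)
  then have "\<And>n. f n + g n \<in> S" "(\<lambda>n. f n + g n) \<longlonglongrightarrow> x + y"
    by (auto intro: cvs.subspace_add[OF assms] tendsto_add)
  then show "x + y \<in> closure S"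
    unfolding closure_sequential by (intro exI[of _ "\<lambda>n. f n + g n"]) simp
next
  fix a x assume "x \<in> closure S"
  then obtain f where "\<And>n. f n \<in> S" "f \<longlonglongrightarrow> x"
    by (auto simp: closure_sequential)
  then have "\<And>n. a *\<^sub>C f n \<in> S" "(\<lambda>n. a *\<^sub>C f n) \<longlonglongrightarrow> a *\<^sub>C x"
    by (auto intro: cvs.subspace_scale[OF assms] bounded_linear.tendsto[OF bounded_linear_scaleC])
  then show "a *\<^sub>C x \<in> closure S"
    unfolding closure_sequential by (intro exI[of _ "\<lambda>n. a *\<^sub>C f n"]) simp
qed

lemma closed_Collect_mem: "closed S \<Longrightarrow> continuous_on UNIV f \<Longrightarrow> closed {x. f x \<in> S}"
  using closed_vimage[of S f] by (simp add: vimage_def)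

lemma csubspace_bounded_ops: "csubspace (bounded_ops :: ('k::complex_hilbert \<Rightarrow>\<^sub>L 'k) set)"
  by (rule cvs.subspaceI)
    (auto simp: bounded_ops_def blinfun.add_left scaleC_blinfun_apply scaleC_add_right
      scaleC_scaleC mult.commute)

lemma closed_bounded_ops: "closed (bounded_ops :: ('k::complex_hilbert \<Rightarrow>\<^sub>L 'k) set)"
  unfolding bounded_ops_def
  by (intro closed_Collect_all closed_Collect_eq continuous_intros
      bounded_linear.continuous_on[OF bounded_linear_scaleC])

lemma compose_bounded_ops: "S \<in> bounded_ops \<Longrightarrow> T \<in> bounded_ops \<Longrightarrow> S o\<^sub>L T \<in> bounded_ops"
  by (simp add: bounded_ops_def)

lemma id_bounded_ops: "id_blinfun \<in> bounded_ops"
  by (simp add: bounded_ops_def)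

lemma scaleC_compose_left: "(a *\<^sub>C S) o\<^sub>L T = a *\<^sub>C (S o\<^sub>L T)"
  for S T :: "'k::complex_hilbert \<Rightarrow>\<^sub>L 'k"
  by (rule blinfun_eqI) (simp add: scaleC_blinfun_apply)

lemma scaleC_compose_right: "S \<in> bounded_ops \<Longrightarrow> S o\<^sub>L (a *\<^sub>C T) = a *\<^sub>C (S o\<^sub>L T)"
  by (rule blinfun_eqI) (simp add: scaleC_blinfun_apply bounded_ops_def)

lemma id_compose: "id_blinfun o\<^sub>L T = T" "T o\<^sub>L id_blinfun = T"
  by (rule blinfun_eqI; simp)+

section \<open>Matrix norms and weighted sums of compressions\<close>

text \<open>
  The supremum that defines \<open>mat_norm\<close> is an upper bound only because it is finite: on the unit
  ball the image is bounded by the sum of the norms of all entries.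
\<close>

lemma mat_norm_upper:
  fixes x :: "nat \<Rightarrow> nat \<Rightarrow> 'k::complex_hilbert \<Rightarrow>\<^sub>L 'k"
  assumes "L2_set (\<lambda>j. norm (\<xi> j)) {..<n} \<le> 1"
  shows "L2_set (\<lambda>i. norm (\<Sum>j<n. blinfun_apply (x i j) (\<xi> j))) {..<n} \<le> mat_norm n x"
  unfolding mat_norm_def
proof (rule cSUP_upper)
  show "bdd_above ((\<lambda>\<xi>. L2_set (\<lambda>i. norm (\<Sum>j<n. blinfun_apply (x i j) (\<xi> j))) {..<n}) `
      {\<xi>. L2_set (\<lambda>j. norm (\<xi> j)) {..<n} \<le> 1})"
  proof (rule bdd_aboveI2)
    fix \<xi> :: "nat \<Rightarrow> 'k"
    assume "\<xi> \<in> {\<xi>. L2_set (\<lambda>j. norm (\<xi> j)) {..<n} \<le> 1}"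
    then have le1: "norm (\<xi> j) \<le> 1" if "j < n" for j
      using member_le_L2_set[of "{..<n}" j "\<lambda>j. norm (\<xi> j)"] that by simp
    have "L2_set (\<lambda>i. norm (\<Sum>j<n. blinfun_apply (x i j) (\<xi> j))) {..<n}
        \<le> (\<Sum>i<n. norm (\<Sum>j<n. blinfun_apply (x i j) (\<xi> j)))"
      by (rule L2_set_le_sum) simp
    also have "\<dots> \<le> (\<Sum>i<n. \<Sum>j<n. norm (x i j))"
    proof (intro sum_mono order_trans[OF norm_sum])
      fix i j assume "i \<in> {..<n}" "j \<in> {..<n}"
      then have "norm (x i j) * norm (\<xi> j) \<le> norm (x i j) * 1"
        by (intro mult_left_mono le1) auto
      then show "norm (blinfun_apply (x i j) (\<xi> j)) \<le> norm (x i j)"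
        using norm_blinfun[of "x i j" "\<xi> j"] by simp
    qed
    finally show "L2_set (\<lambda>i. norm (\<Sum>j<n. blinfun_apply (x i j) (\<xi> j))) {..<n}
        \<le> (\<Sum>i<n. \<Sum>j<n. norm (x i j))" .
  qed
qed (use assms in simp)

lemma mat_norm_nonneg: "0 \<le> mat_norm n x"
  by (rule order_trans[OF L2_set_nonneg mat_norm_upper[of "\<lambda>_. 0"]]) (simp add: L2_set_def)

lemma L2_set_mat_le:
  fixes x :: "nat \<Rightarrow> nat \<Rightarrow> 'k::complex_hilbert \<Rightarrow>\<^sub>L 'k"
  shows "L2_set (\<lambda>i. norm (\<Sum>j<n. blinfun_apply (x i j) (\<xi> j))) {..<n}
    \<le> mat_norm n x * L2_set (\<lambda>j. norm (\<xi> j)) {..<n}"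
proof (cases "L2_set (\<lambda>j. norm (\<xi> j)) {..<n} = 0")
  case True
  then have "\<xi> j = 0" if "j < n" for j
    using that by (simp add: L2_set_eq_0_iff)
  then have "L2_set (\<lambda>i. norm (\<Sum>j<n. blinfun_apply (x i j) (\<xi> j))) {..<n} = 0"
    by (simp add: L2_set_eq_0_iff)
  then show ?thesis using True by simp
next
  case False
  define r where "r = L2_set (\<lambda>j. norm (\<xi> j)) {..<n}"
  have "r > 0" using False L2_set_nonneg unfolding r_def by (simp add: less_le)
  have "L2_set (\<lambda>j. norm (inverse r *\<^sub>R \<xi> j)) {..<n} = inverse r * r"
    using \<open>r > 0\<close> unfolding r_def by (simp flip: L2_set_right_distrib)
  then have "L2_set (\<lambda>i. norm (\<Sum>j<n. blinfun_apply (x i j) (inverse r *\<^sub>R \<xi> j))) {..<n}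
      \<le> mat_norm n x"
    using \<open>r > 0\<close> by (intro mat_norm_upper) simp
  moreover have "L2_set (\<lambda>i. norm (\<Sum>j<n. blinfun_apply (x i j) (inverse r *\<^sub>R \<xi> j))) {..<n}
      = inverse r * L2_set (\<lambda>i. norm (\<Sum>j<n. blinfun_apply (x i j) (\<xi> j))) {..<n}"
    using \<open>r > 0\<close>
    by (simp add: blinfun.scaleR_right L2_set_right_distrib flip: scaleR_sum_right)
  ultimately have "inverse r * L2_set (\<lambda>i. norm (\<Sum>j<n. blinfun_apply (x i j) (\<xi> j))) {..<n}
      \<le> mat_norm n x"
    by simp
  from mult_left_mono[OF this, of r] show ?thesis
    using \<open>r > 0\<close> unfolding r_def[symmetric] by (simp add: mult.commute flip: mult.assoc)
qed

text \<open>
  Norm bounds are expressed through the form \<open>\<Sum> \<langle>x\<^sub>i\<^sub>j \<xi>\<^sub>j, \<eta>\<^sub>i\<rangle>\<close>. The arithmetic mean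
  of the squared norms takes the place of their geometric mean because it is additive in the
  vectors: bounds for several compressions can then be added without a further use of
  the Cauchy-Schwarz inequality. The real inner product is enough, since the norm of a vector is
  attained by pairing it with its own direction.
\<close>

lemma form_le_mat_norm:
  fixes x :: "nat \<Rightarrow> nat \<Rightarrow> 'k::complex_hilbert \<Rightarrow>\<^sub>L 'k"
  shows "(\<Sum>i<n. \<Sum>j<n. inner (blinfun_apply (x i j) (\<xi> j)) (\<eta> i))
    \<le> mat_norm n x * (((\<Sum>j<n. (norm (\<xi> j))\<^sup>2) + (\<Sum>i<n. (norm (\<eta> i))\<^sup>2)) / 2)"
proof -
  let ?r = "L2_set (\<lambda>j. norm (\<xi> j)) {..<n}" and ?s = "L2_set (\<lambda>j. norm (\<eta> j)) {..<n}"
  have "(\<Sum>i<n. \<Sum>j<n. inner (blinfun_apply (x i j) (\<xi> j)) (\<eta> i))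
      \<le> (\<Sum>i<n. norm (\<Sum>j<n. blinfun_apply (x i j) (\<xi> j)) * norm (\<eta> i))"
    unfolding inner_sum_left[symmetric] by (intro sum_mono norm_cauchy_schwarz)
  also have "\<dots> \<le> L2_set (\<lambda>i. norm (\<Sum>j<n. blinfun_apply (x i j) (\<xi> j))) {..<n} * ?s"
    using L2_set_mult_ineq[of "\<lambda>i. norm (\<Sum>j<n. blinfun_apply (x i j) (\<xi> j))"
        "\<lambda>i. norm (\<eta> i)" "{..<n}"] by simp
  also have "\<dots> \<le> (mat_norm n x * ?r) * ?s"
    by (intro mult_right_mono L2_set_mat_le L2_set_nonneg)
  also have "\<dots> \<le> mat_norm n x * ((?r\<^sup>2 + ?s\<^sup>2) / 2)"
  proof -
    have "0 \<le> (?r - ?s)\<^sup>2" by simp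
    then have "?r * ?s \<le> (?r\<^sup>2 + ?s\<^sup>2) / 2" by (simp add: power2_diff)
    from mult_left_mono[OF this mat_norm_nonneg, of n x] show ?thesis by (simp add: mult.assoc)
  qed
  finally show ?thesis
    by (simp add: L2_set_def sum_nonneg)
qed

lemma mat_norm_leI:
  fixes y :: "nat \<Rightarrow> nat \<Rightarrow> 'k::complex_hilbert \<Rightarrow>\<^sub>L 'k"
  assumes "0 \<le> M"
    and "\<And>\<xi> \<eta>. (\<Sum>i<n. \<Sum>j<n. inner (blinfun_apply (y i j) (\<xi> j)) (\<eta> i))
      \<le> M * (((\<Sum>j<n. (norm (\<xi> j))\<^sup>2) + (\<Sum>i<n. (norm (\<eta> i))\<^sup>2)) / 2)"
  shows "mat_norm n y \<le> M"
  unfolding mat_norm_def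
proof (rule cSUP_least)
  have "(\<lambda>_. 0) \<in> {\<xi> :: nat \<Rightarrow> 'k. L2_set (\<lambda>j. norm (\<xi> j)) {..<n} \<le> 1}"
    by (simp add: L2_set_def)
  then show "{\<xi> :: nat \<Rightarrow> 'k. L2_set (\<lambda>j. norm (\<xi> j)) {..<n} \<le> 1} \<noteq> {}"
    unfolding ex_in_conv[symmetric] by (rule exI[of _ "\<lambda>_. 0"])
next
  fix \<xi> :: "nat \<Rightarrow> 'k"
  assume "\<xi> \<in> {\<xi>. L2_set (\<lambda>j. norm (\<xi> j)) {..<n} \<le> 1}"
  then have \<xi>: "(\<Sum>j<n. (norm (\<xi> j))\<^sup>2) \<le> 1"
    by (simp add: L2_set_def)
  define \<zeta> where "\<zeta> i = (\<Sum>j<n. blinfun_apply (y i j) (\<xi> j))" for i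
  define t where "t = L2_set (\<lambda>i. norm (\<zeta> i)) {..<n}"
  have t2: "(\<Sum>i<n. (norm (\<zeta> i))\<^sup>2) = t\<^sup>2"
    unfolding t_def L2_set_def by (simp add: sum_nonneg)
  have "t \<le> M"
  proof (cases "t = 0")
    case True then show ?thesis using assms(1) by simp
  next
    case False
    then have "t > 0" using L2_set_nonneg unfolding t_def by (simp add: less_le)
    define \<eta> where "\<eta> i = inverse t *\<^sub>R \<zeta> i" for i
    have "(\<Sum>i<n. (norm (\<eta> i))\<^sup>2) = (inverse t)\<^sup>2 * (\<Sum>i<n. (norm (\<zeta> i))\<^sup>2)"
      using \<open>t > 0\<close> unfolding sum_distrib_left \<eta>_def by (simp add: power_mult_distrib power_divide)
    then have \<eta>: "(\<Sum>i<n. (norm (\<eta> i))\<^sup>2) = 1"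
      using \<open>t > 0\<close> unfolding t2 by (simp add: power2_eq_square field_simps)
    have "inverse t * (\<Sum>i<n. (norm (\<zeta> i))\<^sup>2) = (\<Sum>i<n. inner (\<zeta> i) (\<eta> i))"
      unfolding sum_distrib_left \<eta>_def by (simp add: power2_norm_eq_inner)
    then have "t = (\<Sum>i<n. inner (\<zeta> i) (\<eta> i))"
      using \<open>t > 0\<close> unfolding t2 by (simp add: power2_eq_square field_simps)
    also have "\<dots> = (\<Sum>i<n. \<Sum>j<n. inner (blinfun_apply (y i j) (\<xi> j)) (\<eta> i))"
      by (simp add: \<zeta>_def inner_sum_left)
    also have "\<dots> \<le> M * (((\<Sum>j<n. (norm (\<xi> j))\<^sup>2) + (\<Sum>i<n. (norm (\<eta> i))\<^sup>2)) / 2)"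
      by (rule assms(2))
    also have "\<dots> \<le> M * 1"
      using \<xi> assms(1) unfolding \<eta> by (intro mult_left_mono) auto
    finally show ?thesis by simp
  qed
  then show "L2_set (\<lambda>i. norm (\<Sum>j<n. blinfun_apply (y i j) (\<xi> j))) {..<n} \<le> M"
    by (simp add: t_def \<zeta>_def)
qed

text \<open>
  The hypothesis says in terms of inner products that \<open>y\<^sub>i\<^sub>j = \<Sum>\<^sub>k w\<^sub>k R\<^sub>k\<^sup>* x\<^sub>i\<^sub>j S\<^sub>k\<close>. Because the
  maps are the same for all entries, the formula passes to the whole matrix, which is what makes
  the later estimates hold at every matrix size.
\<close>

lemma form_sum_compressions:
  assumes "\<And>i j \<xi> \<eta>. i < n \<Longrightarrow> j < n \<Longrightarrow> inner (blinfun_apply (y i j) \<xi>) \<eta>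
      = (\<Sum>k\<in>K. w k * inner (blinfun_apply (x i j) (S k \<xi>)) (R k \<eta>))"
  shows "(\<Sum>i<n. \<Sum>j<n. inner (blinfun_apply (y i j) (\<xi> j)) (\<eta> i))
    = (\<Sum>k\<in>K. w k * (\<Sum>i<n. \<Sum>j<n. inner (blinfun_apply (x i j) (S k (\<xi> j))) (R k (\<eta> i))))"
proof -
  have "(\<Sum>i<n. \<Sum>j<n. inner (blinfun_apply (y i j) (\<xi> j)) (\<eta> i))
    = (\<Sum>i<n. \<Sum>j<n. \<Sum>k\<in>K. w k * inner (blinfun_apply (x i j) (S k (\<xi> j))) (R k (\<eta> i)))"
    using assms by simp
  also have "\<dots> = (\<Sum>i<n. \<Sum>k\<in>K. \<Sum>j<n. w k * inner (blinfun_apply (x i j) (S k (\<xi> j))) (R k (\<eta> i)))"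
    by (intro sum.cong refl sum.swap)
  also have "\<dots> = (\<Sum>k\<in>K. \<Sum>i<n. \<Sum>j<n. w k * inner (blinfun_apply (x i j) (S k (\<xi> j))) (R k (\<eta> i)))"
    by (rule sum.swap)
  finally show ?thesis by (simp add: sum_distrib_left)
qed

lemma mat_norm_sum_compressions_le:
  fixes x :: "nat \<Rightarrow> nat \<Rightarrow> 'k::complex_hilbert \<Rightarrow>\<^sub>L 'k"
    and y :: "nat \<Rightarrow> nat \<Rightarrow> 'l::complex_hilbert \<Rightarrow>\<^sub>L 'l"
  assumes eq: "\<And>i j \<xi> \<eta>. i < n \<Longrightarrow> j < n \<Longrightarrow> inner (blinfun_apply (y i j) \<xi>) \<eta>
      = (\<Sum>k\<in>K. w k * inner (blinfun_apply (x i j) (S k \<xi>)) (R k \<eta>))"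
    and w: "\<And>k. k \<in> K \<Longrightarrow> 0 \<le> w k"
    and S: "\<And>\<xi>. (\<Sum>k\<in>K. w k * (norm (S k \<xi>))\<^sup>2) \<le> (norm \<xi>)\<^sup>2"
    and R: "\<And>\<eta>. (\<Sum>k\<in>K. w k * (norm (R k \<eta>))\<^sup>2) \<le> (norm \<eta>)\<^sup>2"
  shows "mat_norm n y \<le> mat_norm n x"
proof (rule mat_norm_leI[OF mat_norm_nonneg])
  fix \<xi> \<eta> :: "nat \<Rightarrow> 'l"
  let ?M = "mat_norm n x"
  have "(\<Sum>i<n. \<Sum>j<n. inner (blinfun_apply (y i j) (\<xi> j)) (\<eta> i))
      = (\<Sum>k\<in>K. w k * (\<Sum>i<n. \<Sum>j<n. inner (blinfun_apply (x i j) (S k (\<xi> j))) (R k (\<eta> i))))"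
    by (rule form_sum_compressions) (rule eq)
  also have "\<dots> \<le> (\<Sum>k\<in>K. w k * (?M *
      (((\<Sum>j<n. (norm (S k (\<xi> j)))\<^sup>2) + (\<Sum>i<n. (norm (R k (\<eta> i)))\<^sup>2)) / 2)))"
    using w by (intro sum_mono mult_left_mono form_le_mat_norm) auto
  also have "\<dots> = ?M * (((\<Sum>j<n. \<Sum>k\<in>K. w k * (norm (S k (\<xi> j)))\<^sup>2)
      + (\<Sum>i<n. \<Sum>k\<in>K. w k * (norm (R k (\<eta> i)))\<^sup>2)) / 2)"
  proof -
    have swap: "(\<Sum>j<n. \<Sum>k\<in>K. w k * F k j) = (\<Sum>k\<in>K. w k * (\<Sum>j<n. F k j))" for F
      by (subst sum.swap) (simp add: sum_distrib_left)
    have "(\<Sum>k\<in>K. w k * (?M * ((a k + b k) / 2)))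
        = ?M * (((\<Sum>k\<in>K. w k * a k) + (\<Sum>k\<in>K. w k * b k)) / 2)" for a b
      unfolding sum.distrib[symmetric] sum_divide_distrib sum_distrib_left
      by (intro sum.cong refl) (simp add: algebra_simps add_divide_distrib)
    then show ?thesis unfolding swap .
  qed
  also have "\<dots> \<le> ?M * (((\<Sum>j<n. (norm (\<xi> j))\<^sup>2) + (\<Sum>i<n. (norm (\<eta> i))\<^sup>2)) / 2)"
    using S R by (intro mult_left_mono mat_norm_nonneg divide_right_mono add_mono sum_mono) auto
  finally show "(\<Sum>i<n. \<Sum>j<n. inner (blinfun_apply (y i j) (\<xi> j)) (\<eta> i))
      \<le> ?M * (((\<Sum>j<n. (norm (\<xi> j))\<^sup>2) + (\<Sum>i<n. (norm (\<eta> i))\<^sup>2)) / 2)" .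
qed

text \<open>
  Positivity of \<open>x + x\<^sup>*\<close> is a statement about the real inner product alone, because the form of
  \<open>x + x\<^sup>*\<close> is twice the real part of the form of \<open>x\<close>. It is therefore inherited by weighted
  sums of compressions.
\<close>

lemma mat_positive_real_part_iff:
  fixes x :: "nat \<Rightarrow> nat \<Rightarrow> 'k::complex_hilbert \<Rightarrow>\<^sub>L 'k"
  assumes "x \<in> matrices_over n bounded_ops"
  shows "mat_positive n (\<lambda>i j. x i j + mat_adjoint x i j)
    \<longleftrightarrow> (\<forall>\<xi>. 0 \<le> (\<Sum>i<n. \<Sum>j<n. inner (blinfun_apply (x i j) (\<xi> j)) (\<xi> i)))"
proof -
  have sum_left: "cinner (\<Sum>j<n. f j) z = (\<Sum>j<n. cinner (f j) z)" for f and z :: 'k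
  proof (induction n)
    case 0
    show ?case using cinner_scaleC_left[of 0 0 z] by simp
  next
    case (Suc n)
    then show ?case by (simp add: cinner_add_left)
  qed
  have adj: "cinner (blinfun_apply (cadjoint (x j i)) a) b = cnj (cinner (blinfun_apply (x j i) b) a)"
    if "i < n" "j < n" for i j a b
    using that assms cinner_commute[of "blinfun_apply (cadjoint (x j i)) a" b]
    by (simp add: cinner_cadjoint matrices_over_def)
  have "(\<Sum>i<n. cinner (\<Sum>j<n. blinfun_apply (x i j + mat_adjoint x i j) (\<xi> j)) (\<xi> i))
      = complex_of_real (2 * (\<Sum>i<n. \<Sum>j<n. inner (blinfun_apply (x i j) (\<xi> j)) (\<xi> i)))"
    (is "?L = _") for \<xi>
  proof -
    let ?s = "\<Sum>i<n. \<Sum>j<n. cinner (blinfun_apply (x i j) (\<xi> j)) (\<xi> i)"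
    have "?L = ?s + (\<Sum>i<n. \<Sum>j<n. cnj (cinner (blinfun_apply (x j i) (\<xi> i)) (\<xi> j)))"
      by (simp add: sum_left mat_adjoint_def blinfun.add_left cinner_add_left sum.distrib adj)
    also have "(\<Sum>i<n. \<Sum>j<n. cnj (cinner (blinfun_apply (x j i) (\<xi> i)) (\<xi> j))) = cnj ?s"
      by (subst sum.swap) simp
    also have "?s + cnj ?s = complex_of_real (2 * Re ?s)"
      by (rule complex_add_cnj)
    finally show ?thesis
      by (simp only: inner_eq_Re_cinner Re_sum)
  qed
  then show ?thesis
    by (simp add: mat_positive_def complex_nonneg_Reals_iff zero_le_mult_iff)
qed


section \<open>Block operators with one nonzero entry\<close>

definition unit_block ::
  "'n \<Rightarrow> 'n \<Rightarrow> ('h::complex_hilbert \<Rightarrow>\<^sub>L 'h) \<Rightarrow> (('h ^ 'n::finite) \<Rightarrow>\<^sub>L ('h ^ 'n))"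
  where "unit_block p q a = block_op (\<chi> i j. if i = p \<and> j = q then a else 0)"

lemma unit_block_apply:
  "blinfun_apply (unit_block p q a) \<xi> = axis p (blinfun_apply a (\<xi> $ q))"
  by (auto simp: unit_block_def block_op_apply vec_eq_iff axis_def if_distrib[of blinfun_apply]
      if_distrib[of "\<lambda>f. f _"] cong: if_cong)

lemma embed13_eq_unit_block: "embed13 = unit_block 1 3"
  by (simp add: fun_eq_iff embed13_def unit_block_def)

lemma axis_nth_if: "axis i x $ j = (if j = i then x else 0)"
  by (simp add: axis_def)

lemma scaleC_nth: "(a *\<^sub>C x) $ i = a *\<^sub>C (x $ i)"
  by (simp add: scaleC_vec_def)

lemma axis_add: "axis i (x + y) = axis i x + (axis i y :: 'a::real_normed_vector ^ 'n)"
  and axis_scaleR: "axis i (r *\<^sub>R x) = r *\<^sub>R (axis i x :: 'a ^ 'n)"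
  by (simp_all add: vec_eq_iff axis_def)

lemma axis_scaleC: "axis i (a *\<^sub>C x) = a *\<^sub>C (axis i x :: 'a::complex_normed_vector ^ 'n)"
  by (simp add: vec_eq_iff axis_def scaleC_vec_def)

lemma norm_axis: "norm (axis i x :: 'a::real_inner ^ 'n) = norm x"
  by (simp add: norm_eq_sqrt_inner inner_axis_axis)

lemma unit_block_scaleC: "unit_block p q (a *\<^sub>C x) = a *\<^sub>C unit_block p q x"
  by (rule blinfun_eqI) (simp add: unit_block_apply scaleC_blinfun_apply axis_scaleC)

lemma bounded_linear_unit_block: "bounded_linear (unit_block p q)"
proof (rule bounded_linear_intro[where K = 1])
  show "norm (unit_block p q x) \<le> norm x * 1" for x :: "'a \<Rightarrow>\<^sub>L 'a"
  proof (rule norm_blinfun_bound)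
    fix \<xi> :: "'a ^ 'b"
    have "norm (blinfun_apply x (\<xi> $ q)) \<le> norm x * norm (\<xi> $ q)"
      by (rule norm_blinfun)
    also have "\<dots> \<le> norm x * norm \<xi>"
      by (intro mult_left_mono Finite_Cartesian_Product.norm_nth_le norm_ge_zero)
    finally show "norm (blinfun_apply (unit_block p q x) \<xi>) \<le> norm x * 1 * norm \<xi>"
      by (simp add: unit_block_apply norm_axis)
  qed simp
qed (auto intro!: blinfun_eqI simp: unit_block_apply blinfun.add_left blinfun.scaleR_left
    axis_add axis_scaleR)

lemma unit_block_bounded_ops: "a \<in> bounded_ops \<Longrightarrow> unit_block p q a \<in> bounded_ops"
  by (simp add: bounded_ops_def unit_block_apply axis_scaleC scaleC_vec_def)

lemma unit_block_compose:
  "unit_block p q a o\<^sub>L unit_block r s b = (if q = r then unit_block p s (a o\<^sub>L b) else 0)"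
  by (rule blinfun_eqI) (auto simp: unit_block_apply axis_def vec_eq_iff)

lemma block_entry_unit_block:
  "block_entry (unit_block p q a) i j = (if i = p \<and> j = q then a else 0)"
  by (simp add: unit_block_def block_entry_block_op)

lemma block_entry_add: "block_entry (S + T) i j = block_entry S i j + block_entry T i j"
  and block_entry_scaleC: "block_entry (a *\<^sub>C T) i j = a *\<^sub>C block_entry T i j"
  and block_entry_zero: "block_entry 0 i j = 0"
  by (rule blinfun_eqI; simp add: block_entry_apply blinfun.add_left scaleC_blinfun_apply
      scaleC_vec_def)+

lemma block_entry_id: "block_entry id_blinfun i j = (if i = j then id_blinfun else 0)"
  by (rule blinfun_eqI) (simp add: block_entry_apply axis_def)

lemma bounded_linear_block_entry: "bounded_linear (\<lambda>T. block_entry T i j)"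
proof (rule bounded_linear_intro[where K = 1])
  show "norm (block_entry T i j) \<le> norm T * 1" for T :: "('a ^ 'b) \<Rightarrow>\<^sub>L ('a ^ 'b)"
  proof (rule norm_blinfun_bound)
    fix x :: 'a
    have "norm (blinfun_apply T (axis j x) $ i) \<le> norm (blinfun_apply T (axis j x))"
      by (rule Finite_Cartesian_Product.norm_nth_le)
    also have "\<dots> \<le> norm T * norm x"
      using norm_blinfun[of T "axis j x"] by (simp add: norm_axis)
    finally show "norm (blinfun_apply (block_entry T i j) x) \<le> norm T * 1 * norm x"
      by (simp add: block_entry_apply)
  qed simp
qed (auto intro!: blinfun_eqI simp: block_entry_apply blinfun.add_left blinfun.scaleR_left)

lemma block_op_block_entry: "block_op (\<chi> i j. block_entry T i j) = T"
proof (rule blinfun_eqI)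
  fix \<xi> :: "'a ^ 'b"
  have \<xi>: "\<xi> = (\<Sum>j\<in>UNIV. axis j (\<xi> $ j))"
    by (simp add: vec_eq_iff axis_def)
  have "blinfun_apply T \<xi> = (\<Sum>j\<in>UNIV. blinfun_apply T (axis j (\<xi> $ j)))"
    by (subst \<xi>) (simp only: blinfun.sum_right)
  then show "blinfun_apply (block_op (\<chi> i j. block_entry T i j)) \<xi> = blinfun_apply T \<xi>"
    by (simp add: block_op_apply block_entry_apply vec_eq_iff)
qed

text \<open>
  In this form the map is visibly continuous and linear, and its kernel and its complement can be read
  off.
\<close>

lemma replace13_eq_diff: "replace13 T = T - embed13 (block_entry T 1 3)"
proof -
  have "replace13 T + embed13 (block_entry T 1 3) = block_op (\<chi> i j. block_entry T i j)"
    unfolding replace13_def embed13_def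
    by (rule blinfun_eqI) (auto simp: block_op_apply blinfun.add_left vec_eq_iff
        simp flip: sum.distrib intro!: sum.cong)
  then show ?thesis
    by (simp add: block_op_block_entry eq_diff_eq)
qed

lemma subalgebra_compose: "subalgebra B \<Longrightarrow> x \<in> B \<Longrightarrow> y \<in> B \<Longrightarrow> x o\<^sub>L y \<in> B"
  by (simp add: subalgebra_def)

lemma jordan_subalgebra_square: "jordan_subalgebra B \<Longrightarrow> x \<in> B \<Longrightarrow> x o\<^sub>L x \<in> B"
  by (simp add: jordan_subalgebra_def)

section \<open>The algebra of a superdiagonal\<close>

lemma csubspace_product_span: "csubspace (product_span V)"
  unfolding product_span_def by (rule csubspace_closure[OF cvs.subspace_span])

lemma compose_in_product_span:
  "v \<in> V \<Longrightarrow> w \<in> V \<Longrightarrow> fst v o\<^sub>L snd w \<in> product_span V"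
  unfolding product_span_def by (intro subsetD[OF closure_subset] cvs.span_base) blast

lemma product_span_least:
  assumes "csubspace B" "closed B" "\<And>v w. v \<in> V \<Longrightarrow> w \<in> V \<Longrightarrow> fst v o\<^sub>L snd w \<in> B"
  shows "product_span V \<subseteq> B"
  unfolding product_span_def
  using assms by (intro closure_minimal cvs.span_minimal) auto

text \<open>
  The part \<open>N v\<close> carries the entries \<open>v\<^sub>1\<close>, \<open>v\<^sub>2\<close> of the upper left corner and all of the lower right
  one. The data \<open>K\<close>, \<open>weight\<close>, \<open>S\<close> describe the averaging formula: compressing an element by the
  maps \<open>S k\<close> and averaging removes its \<open>1\<close>-\<open>3\<close> entry and nothing else.
\<close>

locale superdiagonal =
  fixes N :: "('h::complex_hilbert \<Rightarrow>\<^sub>L 'h) \<times> ('h \<Rightarrow>\<^sub>L 'h)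
      \<Rightarrow> ('h, 'n::{finite,numeral}) vec \<Rightarrow>\<^sub>L ('h, 'n::{finite,numeral}) vec"
    and V :: "(('h \<Rightarrow>\<^sub>L 'h) \<times> ('h \<Rightarrow>\<^sub>L 'h)) set"
    and K :: "nat set" and weight :: "nat \<Rightarrow> real" and S :: "nat \<Rightarrow> ('h, 'n) vec \<Rightarrow> ('h, 'n) vec"
  assumes index_distinct: "(1 :: 'n) \<noteq> 2" "(1 :: 'n) \<noteq> 3" "(2 :: 'n) \<noteq> 3"
    and N_linear: "bounded_linear N"
    and N_scaleC: "N (a *\<^sub>C v) = a *\<^sub>C N v"
    and N_bounded_ops: "v \<in> bounded_ops \<times> bounded_ops \<Longrightarrow> N v \<in> bounded_ops"
    and N_entries: "block_entry (N v) 1 1 = 0" "block_entry (N v) 1 2 = fst v"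
      "block_entry (N v) 2 3 = snd v" "block_entry (N v) 1 3 = 0"
    and N_compose: "N v o\<^sub>L N w = embed13 (fst v o\<^sub>L snd w)"
    and N_compose_embed13: "N v o\<^sub>L embed13 c = 0" "embed13 c o\<^sub>L N v = 0"
    and V_bounded: "V \<subseteq> bounded_ops \<times> bounded_ops"
    and V_subspace: "csubspace V"
    and V_closed: "closed V"
    and product_nonzero: "product_span V \<noteq> {0}"
    and weight_nonneg: "k \<in> K \<Longrightarrow> 0 \<le> weight k"
    and S_norm: "(\<Sum>k\<in>K. weight k * (norm (S k \<xi>))\<^sup>2) \<le> (norm \<xi>)\<^sup>2"
    and S_average: "v \<in> V \<Longrightarrow> inner (blinfun_apply (l *\<^sub>C id_blinfun + N v) \<xi>) \<eta>
      = (\<Sum>k\<in>K. weight k *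
          inner (blinfun_apply (l *\<^sub>C id_blinfun + N v + embed13 c) (S k \<xi>)) (S k \<eta>))"
begin

definition elt :: "complex \<Rightarrow> ('h \<Rightarrow>\<^sub>L 'h) \<times> ('h \<Rightarrow>\<^sub>L 'h) \<Rightarrow> ('h \<Rightarrow>\<^sub>L 'h)
    \<Rightarrow> ('h, 'n) vec \<Rightarrow>\<^sub>L ('h, 'n) vec"
  where "elt l v c = l *\<^sub>C id_blinfun + N v + embed13 c"

definition alg :: "(('h, 'n) vec \<Rightarrow>\<^sub>L ('h, 'n) vec) set"
  where "alg = {elt l v c | l v c. v \<in> V \<and> c \<in> product_span V}"

abbreviation proj :: "(('h, 'n) vec \<Rightarrow>\<^sub>L ('h, 'n) vec) \<Rightarrow> (('h, 'n) vec \<Rightarrow>\<^sub>L ('h, 'n) vec)"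
  where "proj \<equiv> replace13"

lemma eltI: "v \<in> V \<Longrightarrow> c \<in> product_span V \<Longrightarrow> elt l v c \<in> alg"
  unfolding alg_def by blast

lemma algE:
  assumes "x \<in> alg"
  obtains l v c where "x = elt l v c" "v \<in> V" "c \<in> product_span V"
  using assms by (auto simp: alg_def)

lemma zero_mem: "0 \<in> V" "0 \<in> product_span V"
  by (simp_all add: cvs.subspace_0 V_subspace csubspace_product_span)

lemma N_zero: "N 0 = 0"
  by (simp add: linear_0 bounded_linear.linear N_linear)

lemma N_add: "N (v + w) = N v + N w"
  by (simp add: linear_add bounded_linear.linear N_linear)

lemma embed13_linear: "bounded_linear (embed13 :: _ \<Rightarrow> ('h, 'n) vec \<Rightarrow>\<^sub>L ('h, 'n) vec)"
  by (simp add: embed13_eq_unit_block bounded_linear_unit_block)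

lemma embed13_zero: "embed13 0 = (0 :: ('h, 'n) vec \<Rightarrow>\<^sub>L ('h, 'n) vec)"
  by (simp add: linear_0 bounded_linear.linear embed13_linear)

lemma embed13_add: "embed13 (c + d) = (embed13 c + embed13 d :: ('h, 'n) vec \<Rightarrow>\<^sub>L ('h, 'n) vec)"
  by (simp add: linear_add bounded_linear.linear embed13_linear)

lemma embed13_scaleC: "embed13 (a *\<^sub>C c) = (a *\<^sub>C embed13 c :: ('h, 'n) vec \<Rightarrow>\<^sub>L ('h, 'n) vec)"
  by (simp add: embed13_eq_unit_block unit_block_scaleC)

lemma elt_entries:
  "block_entry (elt l v c) 1 1 = l *\<^sub>C id_blinfun"
  "block_entry (elt l v c) 1 2 = fst v"
  "block_entry (elt l v c) 2 3 = snd v"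
  "block_entry (elt l v c) 1 3 = c"
  using index_distinct
  by (simp_all add: elt_def block_entry_add block_entry_scaleC block_entry_id N_entries
      embed13_eq_unit_block block_entry_unit_block)

lemma elt_add: "elt l v c + elt l' v' c' = elt (l + l') (v + v') (c + c')"
  by (simp add: elt_def N_add embed13_add scaleC_add_left)

lemma elt_scaleC: "a *\<^sub>C elt l v c = elt (a * l) (a *\<^sub>C v) (a *\<^sub>C c)"
  by (simp add: elt_def N_scaleC embed13_scaleC scaleC_add_right scaleC_scaleC)

lemma product_span_bounded: "product_span V \<subseteq> bounded_ops"
  using V_bounded
  by (intro product_span_least csubspace_bounded_ops closed_bounded_ops compose_bounded_ops) auto

lemma elt_compose:
  assumes "v \<in> V" "c \<in> product_span V"
  shows "elt l v c o\<^sub>L elt l' v' c'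
    = elt (l * l') (l *\<^sub>C v' + l' *\<^sub>C v) (l *\<^sub>C c' + l' *\<^sub>C c + (fst v o\<^sub>L snd v'))"
proof -
  interpret comp: bounded_bilinear "(o\<^sub>L) :: (('h, 'n) vec \<Rightarrow>\<^sub>L ('h, 'n) vec) \<Rightarrow> _"
    by (rule bounded_bilinear_blinfun_compose)
  have "N v \<in> bounded_ops" "embed13 c \<in> (bounded_ops :: (('h, 'n) vec \<Rightarrow>\<^sub>L ('h, 'n) vec) set)"
    using assms V_bounded product_span_bounded
    by (auto simp: N_bounded_ops embed13_eq_unit_block unit_block_bounded_ops)
  moreover have "embed13 c o\<^sub>L embed13 c' = (0 :: ('h, 'n) vec \<Rightarrow>\<^sub>L ('h, 'n) vec)"
    using index_distinct by (simp add: embed13_eq_unit_block unit_block_compose)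
  ultimately show ?thesis
    by (simp add: elt_def comp.add_left comp.add_right scaleC_compose_left scaleC_compose_right
        id_compose N_compose N_compose_embed13 N_add N_scaleC embed13_add embed13_scaleC
        scaleC_scaleC scaleC_add_right mult.commute)
qed

lemma alg_subalgebra: "subalgebra alg"
  unfolding subalgebra_def
proof (intro conjI ballI)
  show "alg \<subseteq> bounded_ops"
  proof
    fix x assume "x \<in> alg"
    then obtain l v c where x: "x = elt l v c" "v \<in> V" "c \<in> product_span V" by (rule algE)
    show "x \<in> bounded_ops"
      unfolding x(1) elt_def using x(2,3) V_bounded product_span_bounded
      by (intro cvs.subspace_add cvs.subspace_scale csubspace_bounded_ops id_bounded_ops)
        (auto simp: N_bounded_ops embed13_eq_unit_block unit_block_bounded_ops)
  qed
  show "csubspace alg"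
  proof (rule cvs.subspaceI)
    have "0 = elt 0 0 0" by (simp add: elt_def N_zero embed13_zero)
    then show "0 \<in> alg" using eltI[OF zero_mem] by metis
  next
    fix x y assume "x \<in> alg" "y \<in> alg"
    then obtain l v c l' v' c' where "x = elt l v c" "v \<in> V" "c \<in> product_span V"
      "y = elt l' v' c'" "v' \<in> V" "c' \<in> product_span V"
      by (meson algE)
    then show "x + y \<in> alg"
      unfolding \<open>x = _\<close> \<open>y = _\<close> elt_add
      by (intro eltI cvs.subspace_add V_subspace csubspace_product_span)
  next
    fix a x assume "x \<in> alg"
    then obtain l v c where "x = elt l v c" "v \<in> V" "c \<in> product_span V"
      by (rule algE)
    then show "a *\<^sub>C x \<in> alg"
      unfolding \<open>x = _\<close> elt_scaleC
      by (intro eltI cvs.subspace_scale V_subspace csubspace_product_span)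
  qed
  fix x y assume "x \<in> alg" "y \<in> alg"
  then obtain l v c l' v' c' where xy: "x = elt l v c" "y = elt l' v' c'"
    "v \<in> V" "c \<in> product_span V" "v' \<in> V" "c' \<in> product_span V"
    by (meson algE)
  show "x o\<^sub>L y \<in> alg"
    unfolding xy(1,2) elt_compose[OF xy(3,4)] using xy
    by (intro eltI cvs.subspace_add cvs.subspace_scale
        V_subspace csubspace_product_span compose_in_product_span)
qed

lemma elt_one: "elt 1 0 0 = id_blinfun"
  by (simp add: elt_def N_zero embed13_zero scaleC_one)

lemma elt_embed13: "elt 0 0 c = embed13 c"
  by (simp add: elt_def N_zero)

text \<open>
  The parameters \<open>\<lambda>\<close>, \<open>v\<close>, \<open>c\<close> of an element depend continuously on it, so the algebra is cut
  out by the closed conditions \<open>v \<in> V\<close>, \<open>c \<in> C\<close> and by the equation that rebuilds the element from its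
  parameters.
\<close>

lemma alg_closed: "closed alg"
proof -
  obtain c where "c \<in> product_span V" "c \<noteq> 0"
    using product_nonzero zero_mem(2) by blast
  then obtain h where "blinfun_apply c h \<noteq> 0"
    using blinfun_eqI[of c 0] by auto
  then have "h \<noteq> 0" by auto
  define u where "u = h /\<^sub>R norm h"
  have "norm u = 1" using \<open>h \<noteq> 0\<close> by (simp add: u_def)
  \<comment> \<open>The scalar is recovered from the upper left entry with a unit vector, which exists
    since the underlying space is nonzero.\<close>
  define scalar where "scalar T = cinner (blinfun_apply (block_entry T 1 1) u) u"
    for T :: "('h, 'n) vec \<Rightarrow>\<^sub>L ('h, 'n) vec"
  have scalar_elt: "scalar (elt l v d) = l" for l v d
    using \<open>norm u = 1\<close>
    by (simp add: scalar_def elt_entries scaleC_blinfun_apply cinner_scaleC_left cinner_self)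
  have cinner_linear: "bounded_linear (\<lambda>x. cinner x u)"
  proof -
    have "cinner x u = Complex (inner x u) (- inner (\<i> *\<^sub>C x) u)" for x
      by (simp add: complex_eq_iff inner_eq_Re_cinner cinner_scaleC_left)
    then have "(\<lambda>x. cinner x u) = (\<lambda>x. inner x u *\<^sub>R 1 + (- inner (\<i> *\<^sub>C x) u) *\<^sub>R \<i>)"
      by (simp add: fun_eq_iff complex_eq_iff)
    then show ?thesis
      by (auto intro!: bounded_linear_sub
          bounded_linear_compose[OF bounded_linear_scaleR_left] bounded_linear_inner_left
          bounded_linear_compose[OF bounded_linear_inner_left bounded_linear_scaleC])
  qed
  have scalar_cont: "continuous_on UNIV scalar"
    unfolding scalar_def[abs_def]
    by (intro bounded_linear.continuous_on[OF cinner_linear] continuous_intros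
        bounded_linear.continuous_on[OF bounded_linear_block_entry])
  have "alg = {T. (block_entry T 1 2, block_entry T 2 3) \<in> V} \<inter> {T. block_entry T 1 3 \<in> product_span V}
      \<inter> {T. T = scalar T *\<^sub>C id_blinfun + N (block_entry T 1 2, block_entry T 2 3)
          + embed13 (block_entry T 1 3)}" (is "_ = ?A \<inter> ?B \<inter> ?C")
  proof (intro equalityI subsetI)
    fix x assume "x \<in> alg"
    then obtain l v d where "x = elt l v d" "v \<in> V" "d \<in> product_span V" by (rule algE)
    then show "x \<in> ?A \<inter> ?B \<inter> ?C"
      by (simp add: elt_entries scalar_elt) (simp add: elt_def)
  next
    fix x assume x: "x \<in> ?A \<inter> ?B \<inter> ?C"
    then have "x = elt (scalar x) (block_entry x 1 2, block_entry x 2 3) (block_entry x 1 3)"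
      unfolding elt_def by blast
    then show "x \<in> alg"
      using x by (metis (no_types, lifting) IntD1 IntD2 eltI mem_Collect_eq)
  qed
  moreover have "closed ?A"
    using V_closed
    by (intro closed_Collect_mem continuous_intros
        bounded_linear.continuous_on[OF bounded_linear_block_entry])
  moreover have "closed ?B"
    unfolding product_span_def
    by (intro closed_Collect_mem continuous_intros closed_closure
        bounded_linear.continuous_on[OF bounded_linear_block_entry])
  moreover have "closed ?C"
    by (intro closed_Collect_eq continuous_intros scalar_cont
        bounded_linear.continuous_on[OF bounded_linear_block_entry]
        bounded_linear.continuous_on[OF bounded_linear_scaleC_left]
        bounded_linear.continuous_on[OF N_linear]
        bounded_linear.continuous_on[OF embed13_linear])
  ultimately show ?thesis by (simp add: closed_Int)
qed

lemma alg_unital: "unital_operator_algebra alg"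
  unfolding unital_operator_algebra_def
  using alg_subalgebra alg_closed eltI[OF zero_mem, of 1] by (simp add: elt_one)

lemma proj_elt: "proj (elt l v c) = elt l v 0"
  by (simp add: replace13_eq_diff elt_entries) (simp add: elt_def embed13_zero)

lemma proj_projection: "projection_on alg proj"
  unfolding projection_on_def clinear_on_def
  by (auto elim!: algE simp: proj_elt elt_add elt_scaleC intro!: eltI zero_mem)

lemma proj_one: "proj id_blinfun = id_blinfun"
  by (simp add: proj_elt flip: elt_one)

lemma proj_kernel: "{x \<in> alg. proj x = 0} = embed13 ` product_span V"
proof (intro equalityI subsetI)
  fix x assume "x \<in> {x \<in> alg. proj x = 0}"
  then obtain l v c where x: "x = elt l v c" "c \<in> product_span V" "proj x = 0"
    by (auto elim: algE)
  then have "x = embed13 c"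
    by (simp add: replace13_eq_diff elt_entries)
  then show "x \<in> embed13 ` product_span V" using x by blast
next
  fix x :: "('h, 'n) vec \<Rightarrow>\<^sub>L ('h, 'n) vec" assume "x \<in> embed13 ` product_span V"
  then obtain c where "c \<in> product_span V" "x = elt 0 0 c"
    by (auto simp: elt_embed13)
  then show "x \<in> {x \<in> alg. proj x = 0}"
    by (auto simp: proj_elt intro!: eltI zero_mem) (simp add: elt_embed13 embed13_zero)
qed

lemma embed13_eq_0_iff: "embed13 c = (0 :: ('h, 'n) vec \<Rightarrow>\<^sub>L ('h, 'n) vec) \<longleftrightarrow> c = 0"
  using elt_entries(4)[of 0 0 c] by (auto simp: elt_embed13 embed13_zero block_entry_zero)

lemma kernel_nonzero: "{x \<in> alg. proj x = 0} \<noteq> {0}"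
proof -
  obtain c where "c \<in> product_span V" "c \<noteq> 0"
    using product_nonzero zero_mem(2) by blast
  then show ?thesis
    unfolding proj_kernel using embed13_eq_0_iff by (metis image_eqI singletonD)
qed

lemma id_nonzero: "(id_blinfun :: 'h \<Rightarrow>\<^sub>L 'h) \<noteq> 0"
proof
  assume "(id_blinfun :: 'h \<Rightarrow>\<^sub>L 'h) = 0"
  then have "c = 0" for c :: "'h \<Rightarrow>\<^sub>L 'h"
    using id_compose(2)[of c] by (metis blinfun_compose_zero(2))
  then show False
    using product_nonzero zero_mem(2) by blast
qed

lemma elt_inject: "elt l v c = elt l' v' c' \<longleftrightarrow> l = l' \<and> v = v' \<and> c = c'"
  using elt_entries[of l v c] elt_entries[of l' v' c'] id_nonzero
  by (metis cvs.scale_cancel_right prod.expand)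

lemma kernel_proper: "{x \<in> alg. proj x = 0} \<noteq> alg"
proof
  assume eq: "{x \<in> alg. proj x = 0} = alg"
  have "elt 1 0 0 \<in> alg" by (intro eltI zero_mem)
  then have "proj (elt 1 0 0) = elt 0 0 0"
    using eq by (auto simp: elt_embed13 embed13_zero)
  then show False by (simp add: proj_elt elt_inject)
qed

lemma kernel_ideal: "closed_ideal alg {x \<in> alg. proj x = 0}"
  unfolding closed_ideal_def
proof (intro conjI ballI)
  let ?J = "{x \<in> alg. proj x = 0}"
  show "?J \<subseteq> alg" by blast
  have J: "?J = {elt 0 0 c | c. c \<in> product_span V}"
    unfolding proj_kernel by (auto simp: elt_embed13)
  show "csubspace ?J"
  proof (rule cvs.subspaceI)
    have "(0 :: ('h, 'n) vec \<Rightarrow>\<^sub>L ('h, 'n) vec) = elt 0 0 0" by (simp add: elt_embed13 embed13_zero)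
    then show "0 \<in> ?J" unfolding J using zero_mem(2) by blast
  next
    fix x y assume "x \<in> ?J" "y \<in> ?J"
    then obtain c d where "x = elt 0 0 c" "y = elt 0 0 d" "c \<in> product_span V" "d \<in> product_span V"
      unfolding J by blast
    moreover from this have "c + d \<in> product_span V"
      by (intro cvs.subspace_add csubspace_product_span)
    ultimately show "x + y \<in> ?J" unfolding J by (auto simp: elt_add)
  next
    fix a x assume "x \<in> ?J"
    then obtain c where "x = elt 0 0 c" "c \<in> product_span V"
      unfolding J by blast
    moreover from this have "a *\<^sub>C c \<in> product_span V"
      by (intro cvs.subspace_scale csubspace_product_span)
    ultimately show "a *\<^sub>C x \<in> ?J" unfolding J by (auto simp: elt_scaleC)
  qed
  have "closed {x :: ('h, 'n) vec \<Rightarrow>\<^sub>L ('h, 'n) vec. proj x = 0}"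
    unfolding replace13_eq_diff
    by (intro closed_Collect_eq continuous_intros
        bounded_linear.continuous_on[OF embed13_linear]
        bounded_linear.continuous_on[OF bounded_linear_block_entry])
  from closed_Int[OF alg_closed this] show "closed ?J"
    by (simp add: Int_def)
  fix a x assume "a \<in> alg" "x \<in> ?J"
  then obtain l v c d where ax: "a = elt l v c" "v \<in> V" "c \<in> product_span V"
    "x = elt 0 0 d" "d \<in> product_span V"
    unfolding J by (auto elim: algE)
  have "l *\<^sub>C d \<in> product_span V"
    by (intro cvs.subspace_scale csubspace_product_span ax)
  moreover have "a o\<^sub>L x = elt 0 0 (l *\<^sub>C d)" "x o\<^sub>L a = elt 0 0 (l *\<^sub>C d)"
    using ax by (simp_all add: elt_compose zero_mem)
  ultimately show "a o\<^sub>L x \<in> ?J" "x o\<^sub>L a \<in> ?J"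
    unfolding J by blast+
qed

lemma kernel_square_zero: "square_zero {x \<in> alg. proj x = 0}"
  using index_distinct unfolding square_zero_def proj_kernel
  by (auto simp: embed13_eq_unit_block unit_block_compose)

lemma N_in_range: "v \<in> V \<Longrightarrow> N v \<in> proj ` alg"
  using proj_elt[of 0 v 0] eltI[OF _ zero_mem(2), of v 0]
  by (metis (no_types, lifting) add_0 add.right_neutral cvs.scale_zero_left elt_def embed13_zero image_eqI)

text \<open>
  A closed algebra that contains the range contains \<open>N v o\<^sub>L N w = embed13 (fst v o\<^sub>L snd w)\<close>. The set of
  \<open>c\<close> with \<open>embed13 c\<close> in that algebra is a closed subspace, so it contains all of \<open>product_span V\<close>.
\<close>

lemma kernel_generated: "{x \<in> alg. proj x = 0} \<subseteq> closed_algebra_generated (proj ` alg)"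
  unfolding closed_algebra_generated_def proj_kernel
proof (intro Inter_greatest)
  fix B :: "(('h, 'n) vec \<Rightarrow>\<^sub>L ('h, 'n) vec) set"
  assume "B \<in> {B. subalgebra B \<and> closed B \<and> proj ` alg \<subseteq> B}"
  then have B: "csubspace B" "\<And>x y. x \<in> B \<Longrightarrow> y \<in> B \<Longrightarrow> x o\<^sub>L y \<in> B" "closed B" "proj ` alg \<subseteq> B"
    by (auto simp: subalgebra_def)
  have "product_span V \<subseteq> {c. embed13 c \<in> B}"
  proof (rule product_span_least)
    show "csubspace {c. embed13 c \<in> B}"
      using B(1) by (intro cvs.subspaceI)
        (auto simp: embed13_zero embed13_add embed13_scaleC cvs.subspace_0 cvs.subspace_add
          cvs.subspace_scale)
    show "closed {c. embed13 c \<in> B}"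
      by (rule closed_Collect_mem[OF B(3) linear_continuous_on[OF embed13_linear]])
    fix v w assume "v \<in> V" "w \<in> V"
    then have "N v o\<^sub>L N w \<in> B"
      by (intro B(2) subsetD[OF B(4)] N_in_range)
    then show "fst v o\<^sub>L snd w \<in> {c. embed13 c \<in> B}"
      by (simp add: N_compose)
  qed
  then show "embed13 ` product_span V \<subseteq> B" by blast
qed

lemma embed13_in_rangeD:
  assumes "embed13 c \<in> proj ` alg"
  shows "c = 0"
proof -
  obtain x where "x \<in> alg" "embed13 c = proj x"
    using assms by blast
  then obtain l v where "elt 0 0 c = elt l v 0"
    by (auto elim!: algE simp: proj_elt elt_embed13)
  then show "c = 0" using elt_entries(4) by metis
qed

text \<open>
  Closure under products would put every \<open>embed13 (fst v o\<^sub>L snd w)\<close> into the range, where only \<open>0\<close>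
  has this shape; then all products \<open>fst v o\<^sub>L snd w\<close> would vanish. For a Jordan subalgebra only the
  squares, that is \<open>v = w\<close>, are at hand.
\<close>

lemma range_not_subalgebra: "\<not> subalgebra (proj ` alg)"
proof
  assume "subalgebra (proj ` alg)"
  then have "N v o\<^sub>L N w \<in> proj ` alg" if "v \<in> V" "w \<in> V" for v w
    using that by (intro subalgebra_compose N_in_range)
  then have "fst v o\<^sub>L snd w \<in> {0}" if "v \<in> V" "w \<in> V" for v w
    using that embed13_in_rangeD by (simp add: N_compose)
  then have "product_span V \<subseteq> {0}"
    by (intro product_span_least cvs.subspace_single_0) auto
  then show False using product_nonzero zero_mem(2) by blast
qed

lemma range_not_jordan_subalgebra:
  assumes "v \<in> V" "fst v o\<^sub>L snd v \<noteq> 0"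
  shows "\<not> jordan_subalgebra (proj ` alg)"
proof
  assume "jordan_subalgebra (proj ` alg)"
  then have "N v o\<^sub>L N v \<in> proj ` alg"
    using assms by (intro jordan_subalgebra_square N_in_range)
  then show False using assms embed13_in_rangeD by (simp add: N_compose)
qed

lemma proj_average:
  assumes "x \<in> alg"
  shows "inner (blinfun_apply (proj x) \<xi>) \<eta>
    = (\<Sum>k\<in>K. weight k * inner (blinfun_apply x (S k \<xi>)) (S k \<eta>))"
proof -
  obtain l v c where x: "x = elt l v c" "v \<in> V"
    using assms by (rule algE)
  have "elt l v 0 = l *\<^sub>C id_blinfun + N v"
    by (simp add: elt_def embed13_zero)
  then show ?thesis
    unfolding x(1) proj_elt using S_average[OF x(2), of l \<xi> \<eta> c] by (simp add: elt_def)
qed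

lemma proj_completely_bicontractive: "completely_bicontractive_on alg proj"
  unfolding completely_bicontractive_on_def completely_contractive_on_def
proof (intro conjI allI ballI)
  fix n x assume x: "x \<in> matrices_over n alg"
  show "mat_norm n (amplification proj x) \<le> mat_norm n x"
    using x
    by (intro mat_norm_sum_compressions_le[where K = K and w = weight and S = S and R = S]
        weight_nonneg S_norm) (auto simp: amplification_def matrices_over_def proj_average)
  \<comment> \<open>The complementary projection is the compression that reads coordinate 3 and writes
    coordinate 1.\<close>
  have "inner (blinfun_apply (T - proj T) \<xi>) \<eta>
      = inner (blinfun_apply T (axis 3 (\<xi> $ 3))) (axis 1 (\<eta> $ 1))" for T \<xi> \<eta>
    by (simp add: replace13_eq_diff embed13_eq_unit_block unit_block_apply block_entry_apply
        inner_axis inner_axis')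
  then show "mat_norm n (amplification (\<lambda>x. x - proj x) x) \<le> mat_norm n x"
    by (intro mat_norm_sum_compressions_le[where K = "{0 :: nat}" and w = "\<lambda>_. 1"
          and S = "\<lambda>_ \<xi>. axis 3 (\<xi> $ 3)" and R = "\<lambda>_ \<eta>. axis 1 (\<eta> $ 1)"])
      (auto simp: amplification_def norm_axis
        intro!: power_mono Finite_Cartesian_Product.norm_nth_le)
qed

lemma proj_real_completely_positive: "real_completely_positive_on alg proj"
  unfolding real_completely_positive_on_def
proof (intro allI ballI impI)
  fix n x assume x: "x \<in> matrices_over n alg"
    and pos: "mat_positive n (\<lambda>i j. x i j + mat_adjoint x i j)"
  have alg: "alg \<subseteq> bounded_ops" "proj ` alg \<subseteq> alg"
    using alg_subalgebra proj_projection by (auto simp: subalgebra_def projection_on_def)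
  have xb: "x \<in> matrices_over n bounded_ops"
    using x alg by (auto simp: matrices_over_def)
  have Pxb: "amplification proj x \<in> matrices_over n bounded_ops"
    using x alg by (auto simp: matrices_over_def amplification_def image_subset_iff)
  show "mat_positive n (\<lambda>i j. amplification proj x i j + mat_adjoint (amplification proj x) i j)"
    unfolding mat_positive_real_part_iff[OF Pxb]
  proof
    fix \<xi> :: "nat \<Rightarrow> ('h, 'n) vec"
    have "(\<Sum>i<n. \<Sum>j<n. inner (blinfun_apply (amplification proj x i j) (\<xi> j)) (\<xi> i))
        = (\<Sum>k\<in>K. weight k *
            (\<Sum>i<n. \<Sum>j<n. inner (blinfun_apply (x i j) (S k (\<xi> j))) (S k (\<xi> i))))"
      using x by (intro form_sum_compressions)
        (auto simp: amplification_def matrices_over_def proj_average)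
    also have "\<dots> \<ge> 0"
    proof (rule sum_nonneg, rule mult_nonneg_nonneg)
      fix k assume "k \<in> K"
      then show "0 \<le> weight k" by (rule weight_nonneg)
      show "0 \<le> (\<Sum>i<n. \<Sum>j<n. inner (blinfun_apply (x i j) (S k (\<xi> j))) (S k (\<xi> i)))"
        using pos unfolding mat_positive_real_part_iff[OF xb] by (rule spec)
    qed
    finally show "0 \<le> (\<Sum>i<n. \<Sum>j<n. inner (blinfun_apply (amplification proj x i j) (\<xi> j)) (\<xi> i))" .
  qed
qed

end

section \<open>The seven-dimensional and five-dimensional algebras\<close>

lemma exhaust_5: "x = 1 \<or> x = 2 \<or> x = 3 \<or> x = 4 \<or> x = (5 :: 5)"
proof (induct x)
  case (of_int z)
  then have "z = 0 \<or> z = 1 \<or> z = 2 \<or> z = 3 \<or> z = 4" by fastforce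
  then show ?case by auto
qed

lemma forall_5: "(\<forall>i::5. P i) \<longleftrightarrow> P 1 \<and> P 2 \<and> P 3 \<and> P 4 \<and> P 5"
  by (metis exhaust_5)

lemma sum_5: "sum f (UNIV :: 5 set) = f 1 + f 2 + f 3 + f 4 + f 5"
proof -
  have U: "UNIV = {1, 2, 3, 4, 5 :: 5}" using exhaust_5 by auto
  show ?thesis unfolding U by (simp add: ac_simps)
qed

lemma exhaust_7: "x = 1 \<or> x = 2 \<or> x = 3 \<or> x = 4 \<or> x = 5 \<or> x = 6 \<or> x = (7 :: 7)"
proof (induct x)
  case (of_int z)
  then have "z = 0 \<or> z = 1 \<or> z = 2 \<or> z = 3 \<or> z = 4 \<or> z = 5 \<or> z = 6" by fastforce
  then show ?case by auto
qed

lemma forall_7: "(\<forall>i::7. P i) \<longleftrightarrow> P 1 \<and> P 2 \<and> P 3 \<and> P 4 \<and> P 5 \<and> P 6 \<and> P 7"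
  by (metis exhaust_7)

lemma sum_7: "sum f (UNIV :: 7 set) = f 1 + f 2 + f 3 + f 4 + f 5 + f 6 + f 7"
proof -
  have U: "UNIV = {1, 2, 3, 4, 5, 6, 7 :: 7}" using exhaust_7 by auto
  show ?thesis unfolding U by (simp add: ac_simps)
qed

definition superdiagonal7 ::
  "('h::complex_hilbert \<Rightarrow>\<^sub>L 'h) \<times> ('h \<Rightarrow>\<^sub>L 'h) \<Rightarrow> ('h ^ 7) \<Rightarrow>\<^sub>L ('h ^ 7)"
  where "superdiagonal7 v = unit_block 1 2 (fst v) + unit_block 2 3 (snd v)
    + 2 *\<^sub>C unit_block 4 6 (fst v) + 2 *\<^sub>C unit_block 5 7 (snd v)"

definition superdiagonal5 ::
  "('h::complex_hilbert \<Rightarrow>\<^sub>L 'h) \<times> ('h \<Rightarrow>\<^sub>L 'h) \<Rightarrow> ('h ^ 5) \<Rightarrow>\<^sub>L ('h ^ 5)"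
  where "superdiagonal5 v = unit_block 1 2 (fst v) + unit_block 2 3 (snd v)
    + 2 *\<^sub>C unit_block 4 5 (fst v)"

text \<open>
  The map with \<open>k = 0\<close> keeps the lower right corner. The other two place the first three
  coordinates in the last four so that \<open>2v\<^sub>1\<close> connects the second to the first (for \<open>k = 1\<close>) or \<open>2v\<^sub>2\<close>
  connects the third to the second (for \<open>k = 2\<close>), while the remaining coordinate sees only the
  scalar.
\<close>

definition compression7 :: "nat \<Rightarrow> 'h::complex_hilbert ^ 7 \<Rightarrow> 'h ^ 7"
  where "compression7 k \<xi> =
    (if k = 0 then axis 4 (\<xi> $ 4) + axis 5 (\<xi> $ 5) + axis 6 (\<xi> $ 6) + axis 7 (\<xi> $ 7)
     else if k = 1 then axis 4 (\<xi> $ 1) + axis 6 (\<xi> $ 2) + axis 5 (\<xi> $ 3)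
     else axis 4 (\<xi> $ 1) + axis 5 (\<xi> $ 2) + axis 7 (\<xi> $ 3))"

text \<open>
  There is only one \<open>2 \<times> 2\<close> corner here, so in each half of the average the coordinate left over needs a
  compression of its own: \<open>k = 1, 2\<close> form the half with \<open>2v\<^sub>1\<close>, and \<open>k = 3, 4\<close> the half with \<open>2v\<^sub>2\<close>.
\<close>

definition compression5 :: "nat \<Rightarrow> 'h::complex_hilbert ^ 5 \<Rightarrow> 'h ^ 5"
  where "compression5 k \<xi> =
    (if k = 0 then axis 4 (\<xi> $ 4) + axis 5 (\<xi> $ 5)
     else if k = 1 then axis 4 (\<xi> $ 1) + axis 5 (\<xi> $ 2)
     else if k = 2 then axis 4 (\<xi> $ 3)
     else if k = 3 then axis 4 (\<xi> $ 2) + axis 5 (\<xi> $ 3)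
     else axis 4 (\<xi> $ 1))"

definition averaging_weight :: "nat \<Rightarrow> real"
  where "averaging_weight k = (if k = 0 then 1 else 1 / 2)"

lemma block_entry_scaleC_unit_block:
  "block_entry (a *\<^sub>C unit_block p q x) i j = (if i = p \<and> j = q then a *\<^sub>C x else 0)"
  by (simp add: block_entry_scaleC block_entry_unit_block)

lemma superdiagonal7_interpretation:
  fixes V :: "(('h::complex_hilbert \<Rightarrow>\<^sub>L 'h) \<times> ('h \<Rightarrow>\<^sub>L 'h)) set"
  assumes "V \<subseteq> bounded_ops \<times> bounded_ops" "csubspace V" "closed V" "product_span V \<noteq> {0}"
  shows "superdiagonal superdiagonal7 V {0, 1, 2} averaging_weight compression7"
proof (rule superdiagonal.intro)
  interpret comp: bounded_bilinear "(o\<^sub>L) :: (('h ^ 7) \<Rightarrow>\<^sub>L ('h ^ 7)) \<Rightarrow> _"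
    by (rule bounded_bilinear_blinfun_compose)
  show "(1 :: 7) \<noteq> 2" "(1 :: 7) \<noteq> 3" "(2 :: 7) \<noteq> 3" by simp_all
  show "bounded_linear (superdiagonal7 :: _ \<Rightarrow> ('h ^ 7) \<Rightarrow>\<^sub>L ('h ^ 7))"
    unfolding superdiagonal7_def[abs_def]
    by (intro bounded_linear_add bounded_linear_compose[OF bounded_linear_scaleC]
        bounded_linear_compose[OF bounded_linear_unit_block] bounded_linear_fst bounded_linear_snd)
  fix a l :: complex and v w :: "('h \<Rightarrow>\<^sub>L 'h) \<times> ('h \<Rightarrow>\<^sub>L 'h)" and c :: "'h \<Rightarrow>\<^sub>L 'h"
    and \<xi> \<eta> :: "'h ^ 7"
  show "superdiagonal7 (a *\<^sub>C v) = a *\<^sub>C superdiagonal7 v"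
    by (simp add: superdiagonal7_def scaleC_prod_def unit_block_scaleC scaleC_add_right
        scaleC_scaleC mult.commute)
  show "superdiagonal7 v \<in> bounded_ops" if "v \<in> bounded_ops \<times> bounded_ops"
    using that unfolding superdiagonal7_def
    by (intro cvs.subspace_add cvs.subspace_scale csubspace_bounded_ops unit_block_bounded_ops) auto
  show "block_entry (superdiagonal7 v) 1 1 = 0" "block_entry (superdiagonal7 v) 1 2 = fst v"
    "block_entry (superdiagonal7 v) 2 3 = snd v" "block_entry (superdiagonal7 v) 1 3 = 0"
    by (simp_all add: superdiagonal7_def block_entry_add block_entry_unit_block
        block_entry_scaleC_unit_block)
  show "superdiagonal7 v o\<^sub>L superdiagonal7 w = embed13 (fst v o\<^sub>L snd w)"
    by (simp add: superdiagonal7_def comp.add_left comp.add_right unit_block_compose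
        scaleC_compose_left flip: unit_block_scaleC)
      (simp add: embed13_eq_unit_block)
  show "superdiagonal7 v o\<^sub>L embed13 c = 0" "embed13 c o\<^sub>L superdiagonal7 v = 0"
    by (simp_all add: superdiagonal7_def embed13_eq_unit_block comp.add_left comp.add_right
        unit_block_compose flip: unit_block_scaleC)
  show "0 \<le> averaging_weight k" for k
    by (simp add: averaging_weight_def)
  show "(\<Sum>k\<in>{0, 1, 2}. averaging_weight k * (norm (compression7 k \<xi>))\<^sup>2) \<le> (norm \<xi>)\<^sup>2"
    by (simp add: averaging_weight_def compression7_def power2_norm_eq_inner inner_add_left
        inner_add_right inner_axis' axis_def) (simp add: inner_vec_def sum_7 add_divide_distrib)
  show "inner (blinfun_apply (l *\<^sub>C id_blinfun + superdiagonal7 v) \<xi>) \<eta>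
    = (\<Sum>k\<in>{0, 1, 2}. averaging_weight k *
        inner (blinfun_apply (l *\<^sub>C id_blinfun + superdiagonal7 v + embed13 c)
          (compression7 k \<xi>)) (compression7 k \<eta>))"
    by (simp add: averaging_weight_def compression7_def superdiagonal7_def embed13_eq_unit_block
        blinfun.add_left scaleC_blinfun_apply unit_block_apply inner_add_left inner_add_right
        inner_axis inner_axis' axis_nth_if scaleC_nth scaleC_numeral blinfun.scaleR_left)
      (simp add: inner_vec_def sum_7 scaleC_nth add_divide_distrib)
qed (use assms in auto)

text \<open>
  The assumption \<open>eq\<close> lets the single corner entry \<open>2v\<^sub>1\<close> stand in for \<open>2v\<^sub>2\<close> as well.
\<close>

lemma superdiagonal5_interpretation:
  fixes V :: "(('h::complex_hilbert \<Rightarrow>\<^sub>L 'h) \<times> ('h \<Rightarrow>\<^sub>L 'h)) set"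
  assumes "V \<subseteq> bounded_ops \<times> bounded_ops" "csubspace V" "closed V" "product_span V \<noteq> {0}"
    and eq: "\<And>v. v \<in> V \<Longrightarrow> snd v = fst v"
  shows "superdiagonal superdiagonal5 V {0, 1, 2, 3, 4} averaging_weight compression5"
proof (rule superdiagonal.intro)
  interpret comp: bounded_bilinear "(o\<^sub>L) :: (('h ^ 5) \<Rightarrow>\<^sub>L ('h ^ 5)) \<Rightarrow> _"
    by (rule bounded_bilinear_blinfun_compose)
  show "(1 :: 5) \<noteq> 2" "(1 :: 5) \<noteq> 3" "(2 :: 5) \<noteq> 3" by simp_all
  show "bounded_linear (superdiagonal5 :: _ \<Rightarrow> ('h ^ 5) \<Rightarrow>\<^sub>L ('h ^ 5))"
    unfolding superdiagonal5_def[abs_def]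
    by (intro bounded_linear_add bounded_linear_compose[OF bounded_linear_scaleC]
        bounded_linear_compose[OF bounded_linear_unit_block] bounded_linear_fst bounded_linear_snd)
  fix a l :: complex and v w :: "('h \<Rightarrow>\<^sub>L 'h) \<times> ('h \<Rightarrow>\<^sub>L 'h)" and c :: "'h \<Rightarrow>\<^sub>L 'h"
    and \<xi> \<eta> :: "'h ^ 5"
  show "superdiagonal5 (a *\<^sub>C v) = a *\<^sub>C superdiagonal5 v"
    by (simp add: superdiagonal5_def scaleC_prod_def unit_block_scaleC scaleC_add_right
        scaleC_scaleC mult.commute)
  show "superdiagonal5 v \<in> bounded_ops" if "v \<in> bounded_ops \<times> bounded_ops"
    using that unfolding superdiagonal5_def
    by (intro cvs.subspace_add cvs.subspace_scale csubspace_bounded_ops unit_block_bounded_ops) auto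
  show "block_entry (superdiagonal5 v) 1 1 = 0" "block_entry (superdiagonal5 v) 1 2 = fst v"
    "block_entry (superdiagonal5 v) 2 3 = snd v" "block_entry (superdiagonal5 v) 1 3 = 0"
    by (simp_all add: superdiagonal5_def block_entry_add block_entry_unit_block
        block_entry_scaleC_unit_block)
  show "superdiagonal5 v o\<^sub>L superdiagonal5 w = embed13 (fst v o\<^sub>L snd w)"
    by (simp add: superdiagonal5_def comp.add_left comp.add_right unit_block_compose
        scaleC_compose_left flip: unit_block_scaleC)
      (simp add: embed13_eq_unit_block)
  show "superdiagonal5 v o\<^sub>L embed13 c = 0" "embed13 c o\<^sub>L superdiagonal5 v = 0"
    by (simp_all add: superdiagonal5_def embed13_eq_unit_block comp.add_left comp.add_right
        unit_block_compose flip: unit_block_scaleC)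
  show "0 \<le> averaging_weight k" for k
    by (simp add: averaging_weight_def)
  show "(\<Sum>k\<in>{0, 1, 2, 3, 4}. averaging_weight k * (norm (compression5 k \<xi>))\<^sup>2) \<le> (norm \<xi>)\<^sup>2"
    by (simp add: averaging_weight_def compression5_def power2_norm_eq_inner inner_add_left
        inner_add_right inner_axis' axis_def) (simp add: inner_vec_def sum_5 add_divide_distrib)
  show "inner (blinfun_apply (l *\<^sub>C id_blinfun + superdiagonal5 v) \<xi>) \<eta>
    = (\<Sum>k\<in>{0, 1, 2, 3, 4}. averaging_weight k *
        inner (blinfun_apply (l *\<^sub>C id_blinfun + superdiagonal5 v + embed13 c)
          (compression5 k \<xi>)) (compression5 k \<eta>))" if "v \<in> V"
    using eq[OF that]
    by (simp add: averaging_weight_def compression5_def superdiagonal5_def embed13_eq_unit_block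
        blinfun.add_left scaleC_blinfun_apply unit_block_apply inner_add_left inner_add_right
        inner_axis inner_axis' axis_nth_if scaleC_nth scaleC_numeral blinfun.scaleR_left)
      (simp add: inner_vec_def sum_5 scaleC_nth add_divide_distrib)
qed (use assms in auto)

lemma algebra_elt_eq: "algebra_elt l v c = l *\<^sub>C id_blinfun + superdiagonal7 v + embed13 c"
  by (rule blinfun_eqI)
    (simp add: algebra_elt_def superdiagonal7_def embed13_eq_unit_block block_op_apply
      blinfun.add_left scaleC_blinfun_apply unit_block_apply vec_eq_iff forall_7 sum_7
      scaleC_vec_def axis_def)

lemma algebra_of_eq:
  "algebra_of V =
    {l *\<^sub>C id_blinfun + superdiagonal7 v + embed13 c | l v c. v \<in> V \<and> c \<in> product_span V}"
  by (simp add: algebra_of_def algebra_elt_eq)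

section \<open>The scalar case\<close>

text \<open>
  A complex-linear map on \<open>\<complex>\<close> is multiplication by its value at \<open>1\<close>.
\<close>

lemma bounded_ops_complex:
  "(bounded_ops :: (complex \<Rightarrow>\<^sub>L complex) set) = range (\<lambda>a. a *\<^sub>C id_blinfun)"
proof (intro equalityI subsetI)
  fix T :: "complex \<Rightarrow>\<^sub>L complex" assume T: "T \<in> bounded_ops"
  have "T = blinfun_apply T 1 *\<^sub>C id_blinfun"
  proof (rule blinfun_eqI)
    fix z
    have "blinfun_apply T z = blinfun_apply T (z *\<^sub>C 1)" by (simp add: scaleC_complex_def)
    also have "\<dots> = z *\<^sub>C blinfun_apply T 1" using T by (simp add: bounded_ops_def)
    finally show "blinfun_apply T z = blinfun_apply (blinfun_apply T 1 *\<^sub>C id_blinfun) z"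
      by (simp add: scaleC_blinfun_apply) (simp add: scaleC_complex_def)
  qed
  then show "T \<in> range (\<lambda>a. a *\<^sub>C id_blinfun)" by (rule range_eqI)
qed (auto intro!: cvs.subspace_scale csubspace_bounded_ops id_bounded_ops)

lemma scalar_pairs_eq: "scalar_pairs = {p. fst p = snd p} \<inter> {p. fst p \<in> bounded_ops}"
  unfolding scalar_pairs_def bounded_ops_complex by (auto simp: prod_eq_iff)

lemma csubspace_scalar_pairs: "csubspace scalar_pairs"
  unfolding scalar_pairs_eq
  by (rule cvs.subspaceI)
    (auto simp: scaleC_prod_def intro: cvs.subspace_0 cvs.subspace_add cvs.subspace_scale
      csubspace_bounded_ops)

lemma closed_scalar_pairs: "closed scalar_pairs"
  unfolding scalar_pairs_eq
  by (intro closed_Int closed_Collect_eq closed_Collect_mem closed_bounded_ops continuous_intros)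

lemma product_span_scalar_pairs: "product_span scalar_pairs = bounded_ops"
proof
  show "product_span scalar_pairs \<subseteq> bounded_ops"
    by (intro product_span_least csubspace_bounded_ops closed_bounded_ops compose_bounded_ops)
      (auto simp: scalar_pairs_eq)
  show "bounded_ops \<subseteq> product_span scalar_pairs"
  proof
    fix T :: "complex \<Rightarrow>\<^sub>L complex" assume "T \<in> bounded_ops"
    then have "(T, T) \<in> scalar_pairs" "(id_blinfun, id_blinfun) \<in> scalar_pairs"
      by (simp_all add: scalar_pairs_eq id_bounded_ops)
    from compose_in_product_span[OF this] show "T \<in> product_span scalar_pairs"
      by (simp add: id_compose)
  qed
qed

lemma id_complex_nonzero: "(id_blinfun :: complex \<Rightarrow>\<^sub>L complex) \<noteq> 0"
  by (metis blinfun.zero_left blinfun_apply_id_blinfun zero_neq_one)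

lemma product_span_scalar_pairs_nonzero: "product_span scalar_pairs \<noteq> {0}"
  using id_bounded_ops id_complex_nonzero unfolding product_span_scalar_pairs by blast

lemma scalar_pairs_bounded: "scalar_pairs \<subseteq> bounded_ops \<times> bounded_ops"
  by (auto simp: scalar_pairs_eq)

lemma matrix_op_algebra5_eq:
  "matrix_op (\<chi> i j.
      if i = j then l
      else if i = 1 \<and> j = 2 \<or> i = 2 \<and> j = 3 then \<nu>
      else if i = 1 \<and> j = 3 then c
      else if i = 4 \<and> j = 5 then 2 * \<nu>
      else 0)
    = l *\<^sub>C id_blinfun + superdiagonal5 (\<nu> *\<^sub>C id_blinfun, \<nu> *\<^sub>C id_blinfun)
      + embed13 (c *\<^sub>C id_blinfun)"
  by (rule blinfun_eqI)
    (simp add: matrix_op_eq_block_op superdiagonal5_def embed13_eq_unit_block block_op_apply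
      blinfun.add_left scaleC_blinfun_apply unit_block_apply vec_eq_iff forall_5 sum_5
      scaleC_nth axis_nth_if scaleC_scaleC)

lemma algebra5_eq:
  "algebra5 = {l *\<^sub>C id_blinfun + superdiagonal5 v + embed13 c | l v c.
    v \<in> scalar_pairs \<and> c \<in> product_span scalar_pairs}"
  unfolding algebra5_def matrix_op_algebra5_eq product_span_scalar_pairs bounded_ops_complex
  unfolding scalar_pairs_def by blast

lemmas scalar_superdiagonal7 = superdiagonal7_interpretation[OF scalar_pairs_bounded
    csubspace_scalar_pairs closed_scalar_pairs product_span_scalar_pairs_nonzero]

lemma scalar_superdiagonal5:
  "superdiagonal superdiagonal5 scalar_pairs {0, 1, 2, 3, 4} averaging_weight compression5"
  by (intro superdiagonal5_interpretation scalar_pairs_bounded csubspace_scalar_pairs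
      closed_scalar_pairs product_span_scalar_pairs_nonzero) (simp add: scalar_pairs_eq)

text \<open>
  The indices \<open>5\<close> and \<open>7\<close> of the second copy of the \<open>2 \<times> 2\<close> corner are skipped.
\<close>

definition retained_index :: "5 \<Rightarrow> 7"
  where "retained_index i =
    (if i = 1 then 1 else if i = 2 then 2 else if i = 3 then 3 else if i = 4 then 4 else 6)"

definition restrict_blocks ::
  "(('h::complex_hilbert ^ 7) \<Rightarrow>\<^sub>L ('h ^ 7)) \<Rightarrow> ('h ^ 5) \<Rightarrow>\<^sub>L ('h ^ 5)"
  where "restrict_blocks T =
    block_op (\<chi> i j. block_entry T (retained_index i) (retained_index j))"

lemma restrict_blocks_elt:
  "restrict_blocks (l *\<^sub>C id_blinfun + superdiagonal7 v + embed13 c)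
    = l *\<^sub>C id_blinfun + superdiagonal5 v + embed13 c"
  by (rule blinfun_eqI)
    (simp add: restrict_blocks_def retained_index_def block_op_apply block_entry_apply
      superdiagonal7_def superdiagonal5_def embed13_eq_unit_block
      blinfun.add_left scaleC_blinfun_apply unit_block_apply vec_eq_iff forall_5 sum_5
      scaleC_nth axis_nth_if)

definition include5 :: "'h::complex_hilbert ^ 5 \<Rightarrow> 'h ^ 7"
  where "include5 \<xi> = axis 1 (\<xi> $ 1) + axis 2 (\<xi> $ 2) + axis 3 (\<xi> $ 3) + axis 4 (\<xi> $ 4)
    + axis 6 (\<xi> $ 5)"

text \<open>
  The second copy of the \<open>2 \<times> 2\<close> corner, on the coordinates \<open>5\<close> and \<open>7\<close>, is recovered from the
  retained one on the coordinates \<open>4\<close> and \<open>5\<close>.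
\<close>

definition split7 :: "nat \<Rightarrow> 'h::complex_hilbert ^ 7 \<Rightarrow> 'h ^ 5"
  where "split7 k \<xi> =
    (if k = 0 then axis 1 (\<xi> $ 1) + axis 2 (\<xi> $ 2) + axis 3 (\<xi> $ 3) + axis 4 (\<xi> $ 4)
       + axis 5 (\<xi> $ 6)
     else axis 4 (\<xi> $ 5) + axis 5 (\<xi> $ 7))"

lemma inner_elt5:
  "inner (blinfun_apply (l *\<^sub>C id_blinfun + superdiagonal5 v + embed13 c) \<xi>) \<eta>
    = inner (blinfun_apply (l *\<^sub>C id_blinfun + superdiagonal7 v + embed13 c) (include5 \<xi>))
        (include5 \<eta>)"
  by (simp add: include5_def superdiagonal7_def superdiagonal5_def embed13_eq_unit_block
      blinfun.add_left scaleC_blinfun_apply unit_block_apply inner_add_left inner_add_right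
      inner_axis inner_axis' axis_nth_if scaleC_nth scaleC_numeral blinfun.scaleR_left)
    (simp add: inner_vec_def sum_5 scaleC_nth)

lemma inner_elt7:
  assumes "snd v = fst v"
  shows "inner (blinfun_apply (l *\<^sub>C id_blinfun + superdiagonal7 v + embed13 c) \<xi>) \<eta>
    = (\<Sum>k\<in>{0, 1}. 1 * inner (blinfun_apply (l *\<^sub>C id_blinfun + superdiagonal5 v + embed13 c)
        (split7 k \<xi>)) (split7 k \<eta>))"
  using assms
  by (simp add: split7_def superdiagonal7_def superdiagonal5_def embed13_eq_unit_block
      blinfun.add_left scaleC_blinfun_apply unit_block_apply inner_add_left inner_add_right
      inner_axis inner_axis' axis_nth_if scaleC_nth scaleC_numeral blinfun.scaleR_left)
    (simp add: inner_vec_def sum_7 scaleC_nth)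

lemma norm_include5: "(norm (include5 \<xi>))\<^sup>2 = (norm \<xi>)\<^sup>2"
  by (simp add: include5_def power2_norm_eq_inner inner_add_left inner_add_right inner_axis'
      axis_nth_if) (simp add: inner_vec_def sum_5)

lemma norm_split7: "(\<Sum>k\<in>{0, 1}. (norm (split7 k \<xi>))\<^sup>2) = (norm \<xi>)\<^sup>2"
  by (simp add: split7_def power2_norm_eq_inner inner_add_left inner_add_right inner_axis'
      axis_nth_if) (simp add: inner_vec_def sum_7)

text \<open>
  Both algebras multiply their parameters \<open>\<lambda>\<close>, \<open>v\<close>, \<open>c\<close> by the same rule, and \<open>restrict_blocks\<close>
  preserves these parameters. The matrix norms agree because each algebra is obtained from the other by
  compressions, \<open>inner_elt5\<close> and \<open>inner_elt7\<close>.
\<close>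

lemma restrict_blocks_isomorphism:
  "completely_isometric_isomorphism (algebra_of scalar_pairs) algebra5 restrict_blocks"
proof -
  interpret A: superdiagonal superdiagonal7 scalar_pairs "{0, 1, 2}" averaging_weight compression7
    by (rule scalar_superdiagonal7)
  interpret B: superdiagonal superdiagonal5 scalar_pairs "{0, 1, 2, 3, 4}" averaging_weight
    compression5
    by (rule scalar_superdiagonal5)
  have f: "restrict_blocks (A.elt l v c) = B.elt l v c" for l v c
    by (simp only: A.elt_def B.elt_def restrict_blocks_elt)
  have "completely_isometric_isomorphism A.alg B.alg restrict_blocks"
    unfolding completely_isometric_isomorphism_def
  proof (intro conjI ballI allI)
    have "inj_on restrict_blocks A.alg"
    proof (rule inj_onI)
      fix x y assume "x \<in> A.alg" "y \<in> A.alg" "restrict_blocks x = restrict_blocks y"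
      then show "x = y"
        by (elim A.algE) (simp only: f B.elt_inject)
    qed
    moreover have "restrict_blocks ` A.alg = B.alg"
    proof (intro equalityI subsetI)
      fix y assume "y \<in> restrict_blocks ` A.alg"
      then show "y \<in> B.alg"
        by (elim imageE A.algE) (simp only: f B.eltI)
    next
      fix y assume "y \<in> B.alg"
      then obtain l v c where "y = B.elt l v c" "v \<in> scalar_pairs" "c \<in> product_span scalar_pairs"
        by (rule B.algE)
      then show "y \<in> restrict_blocks ` A.alg"
        by (intro image_eqI[of _ _ "A.elt l v c"] A.eltI) (simp only: f)
    qed
    ultimately show "bij_betw restrict_blocks A.alg B.alg"
      by (simp add: bij_betw_def)
    show "clinear_on A.alg restrict_blocks"
      unfolding clinear_on_def
    proof (intro conjI ballI allI)
      fix x y assume "x \<in> A.alg" "y \<in> A.alg"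
      then show "restrict_blocks (x + y) = restrict_blocks x + restrict_blocks y"
        by (elim A.algE) (simp only: f A.elt_add B.elt_add)
    next
      fix a x assume "x \<in> A.alg"
      then show "restrict_blocks (a *\<^sub>C x) = a *\<^sub>C restrict_blocks x"
        by (elim A.algE) (simp only: f A.elt_scaleC B.elt_scaleC)
    qed
    fix x y assume "x \<in> A.alg" "y \<in> A.alg"
    then show "restrict_blocks (x o\<^sub>L y) = restrict_blocks x o\<^sub>L restrict_blocks y"
      by (elim A.algE) (simp only: f A.elt_compose B.elt_compose)
  next
    fix n x assume x: "x \<in> matrices_over n A.alg"
    have xE: "\<exists>l v c. x i j = l *\<^sub>C id_blinfun + superdiagonal7 v + embed13 c \<and> snd v = fst v"
      if "i < n" "j < n" for i j
    proof -
      have "x i j \<in> A.alg" using x that by (simp add: matrices_over_def)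
      then obtain l v c where "x i j = A.elt l v c" "v \<in> scalar_pairs" by (rule A.algE)
      moreover from this have "snd v = fst v" by (simp add: scalar_pairs_eq)
      ultimately show ?thesis unfolding A.elt_def by blast
    qed
    show "mat_norm n (amplification restrict_blocks x) = mat_norm n x"
    proof (rule antisym)
      show "mat_norm n (amplification restrict_blocks x) \<le> mat_norm n x"
      proof (rule mat_norm_sum_compressions_le[where K = "{0 :: nat}" and w = "\<lambda>_. 1"
            and S = "\<lambda>_. include5" and R = "\<lambda>_. include5"])
        fix i j and \<xi> \<eta> :: "complex ^ 5" assume "i < n" "j < n"
        then obtain l v c where "x i j = l *\<^sub>C id_blinfun + superdiagonal7 v + embed13 c"
          using xE by blast
        then show "inner (blinfun_apply (amplification restrict_blocks x i j) \<xi>) \<eta>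
            = (\<Sum>k\<in>{0 :: nat}. 1 * inner (blinfun_apply (x i j) (include5 \<xi>)) (include5 \<eta>))"
          by (simp only: amplification_def restrict_blocks_elt inner_elt5) simp
      qed (simp_all add: norm_include5)
      show "mat_norm n x \<le> mat_norm n (amplification restrict_blocks x)"
      proof (rule mat_norm_sum_compressions_le[where K = "{0 :: nat, 1}" and w = "\<lambda>_. 1"
            and S = split7 and R = split7])
        fix i j and \<xi> \<eta> :: "complex ^ 7" assume "i < n" "j < n"
        then obtain l v c where "x i j = l *\<^sub>C id_blinfun + superdiagonal7 v + embed13 c"
          "snd v = fst v"
          using xE by blast
        then show "inner (blinfun_apply (x i j) \<xi>) \<eta> = (\<Sum>k\<in>{0 :: nat, 1}. 1 *
            inner (blinfun_apply (amplification restrict_blocks x i j) (split7 k \<xi>)) (split7 k \<eta>))"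
          by (simp only: amplification_def restrict_blocks_elt inner_elt7)
      qed (simp_all only: mult_1 norm_split7 order_refl zero_le_one)
    qed
  qed
  then show ?thesis
    unfolding A.alg_def B.alg_def A.elt_def B.elt_def algebra_of_eq algebra5_eq .
qed

lemma restrict_blocks_replace13:
  assumes "x \<in> algebra_of scalar_pairs"
  shows "restrict_blocks (replace13 x) = replace13 (restrict_blocks x)"
proof -
  interpret A: superdiagonal superdiagonal7 scalar_pairs "{0, 1, 2}" averaging_weight compression7
    by (rule scalar_superdiagonal7)
  interpret B: superdiagonal superdiagonal5 scalar_pairs "{0, 1, 2, 3, 4}" averaging_weight
    compression5
    by (rule scalar_superdiagonal5)
  have f: "restrict_blocks (A.elt l v c) = B.elt l v c" for l v c
    by (simp only: A.elt_def B.elt_def restrict_blocks_elt)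
  obtain l v c where "x = A.elt l v c"
    using assms unfolding algebra_of_eq A.elt_def by blast
  then show ?thesis
    by (simp only: f A.proj_elt B.proj_elt)
qed

theorem corollary4p8:
  fixes V :: "(('h::complex_hilbert \<Rightarrow>\<^sub>L 'h) \<times> ('h \<Rightarrow>\<^sub>L 'h)) set"
  assumes "V \<subseteq> bounded_ops \<times> bounded_ops"
    and "csubspace V"
    and "closed V"
    and "product_span V \<noteq> {0}"
  shows
    "(let A = algebra_of V;
          P = (replace13 :: (('h ^ 7) \<Rightarrow>\<^sub>L ('h ^ 7)) \<Rightarrow> (('h ^ 7) \<Rightarrow>\<^sub>L ('h ^ 7)));
          J = {x \<in> A. P x = 0}
      in unital_operator_algebra A
       \<and> projection_on A P
       \<and> J = embed13 ` product_span V
       \<and> J \<noteq> {0} \<and> J \<noteq> A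
       \<and> closed_ideal A J \<and> square_zero J
       \<and> J \<subseteq> closed_algebra_generated (P ` A)
       \<and> real_completely_positive_on A P
       \<and> completely_bicontractive_on A P
       \<and> P id_blinfun = id_blinfun
       \<and> \<not> subalgebra (P ` A))
   \<and> scalar_pairs \<subseteq> bounded_ops \<times> bounded_ops
   \<and> csubspace scalar_pairs
   \<and> closed scalar_pairs
   \<and> product_span scalar_pairs \<noteq> {0}
   \<and> \<not> jordan_subalgebra (replace13 ` algebra_of scalar_pairs)
   \<and> (\<exists>f. completely_isometric_isomorphism (algebra_of scalar_pairs) algebra5 f
        \<and> (\<forall>x\<in>algebra_of scalar_pairs. f (replace13 x) = replace13 (f x)))
   \<and> (let A = algebra5;
          P = (replace13 :: ((complex ^ 5) \<Rightarrow>\<^sub>L (complex ^ 5)) \<Rightarrow> ((complex ^ 5) \<Rightarrow>\<^sub>L (complex ^ 5)));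
          J = {x \<in> A. P x = 0}
      in unital_operator_algebra A
       \<and> projection_on A P
       \<and> J = embed13 ` bounded_ops
       \<and> J \<noteq> {0} \<and> J \<noteq> A
       \<and> closed_ideal A J \<and> square_zero J
       \<and> J \<subseteq> closed_algebra_generated (P ` A)
       \<and> real_completely_positive_on A P
       \<and> completely_bicontractive_on A P
       \<and> P id_blinfun = id_blinfun
       \<and> \<not> subalgebra (P ` A)
       \<and> \<not> jordan_subalgebra (P ` A))"
proof -
  interpret A: superdiagonal superdiagonal7 V "{0, 1, 2}" averaging_weight compression7
    by (rule superdiagonal7_interpretation) fact+
  interpret B: superdiagonal superdiagonal7 scalar_pairs "{0, 1, 2}" averaging_weight compression7
    by (rule scalar_superdiagonal7)
  interpret C: superdiagonal superdiagonal5 scalar_pairs "{0, 1, 2, 3, 4}" averaging_weight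
    compression5
    by (rule scalar_superdiagonal5)
  have A: "algebra_of V = A.alg" and B: "algebra_of scalar_pairs = B.alg"
    and C: "algebra5 = C.alg"
    unfolding algebra_of_eq algebra5_eq A.alg_def A.elt_def B.alg_def B.elt_def C.alg_def C.elt_def
    by (rule refl)+
  have ident: "(id_blinfun, id_blinfun) \<in> scalar_pairs"
    "fst (id_blinfun, id_blinfun) o\<^sub>L snd (id_blinfun, id_blinfun) \<noteq> (0 :: complex \<Rightarrow>\<^sub>L complex)"
    by (simp_all add: scalar_pairs_eq id_bounded_ops id_compose id_complex_nonzero)
  have iso: "\<exists>f. completely_isometric_isomorphism (algebra_of scalar_pairs) algebra5 f
      \<and> (\<forall>x\<in>algebra_of scalar_pairs. f (replace13 x) = replace13 (f x))"
    using restrict_blocks_isomorphism restrict_blocks_replace13 by blast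
  show ?thesis
    unfolding Let_def
    by (intro conjI iso, unfold A B C)
      (rule A.alg_unital A.proj_projection A.proj_kernel A.kernel_nonzero A.kernel_proper
        A.kernel_ideal A.kernel_square_zero A.kernel_generated A.proj_real_completely_positive
        A.proj_completely_bicontractive A.proj_one A.range_not_subalgebra
        scalar_pairs_bounded csubspace_scalar_pairs closed_scalar_pairs
        product_span_scalar_pairs_nonzero B.range_not_jordan_subalgebra[OF ident]
        C.alg_unital C.proj_projection C.proj_kernel[unfolded product_span_scalar_pairs]
        C.kernel_nonzero C.kernel_proper
        C.kernel_ideal C.kernel_square_zero C.kernel_generated C.proj_real_completely_positive
        C.proj_completely_bicontractive C.proj_one C.range_not_subalgebra
        C.range_not_jordan_subalgebra[OF ident])+
qed

end
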